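(* Let $\mathbb F$ be a non-Archimedean local field (of any characteristic) with residual characteristic $p$, and let $G$ be a linear algebraic $\mathbb F$-group. Suppose that $g\in G(\mathbb F)$ has $p^k$-th roots in $G(\mathbb F)$ for all $k\in\mathbb N$, i.e. for every $k\in\mathbb N$ there is $h\in G(\mathbb F)$ with $h^{p^k}=g$. Then some power of $g$ is unipotent, i.e. there exists $r\in\mathbb N$, $r\ge 1$, such that $g^r$ is unipotent.
   Context: The residual characteristic of $\mathbb F$ is the characteristic of its (finite) residue field. *)

theory Defs
  imports
    "HOL-Analysis.Abstract_Metric_Spaces"
    "HOL-Algebra.Algebraic_Closure_Type"
    "HOL-Algebra.QuotRing"
    "HOL-Library.Poly_Mapping"
    "Jordan_Normal_Form.Determinant"
begin

section \<open>Non-Archimedean local fields\<close>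

text \<open>
  A non-Archimedean local field is a field that is complete with respect to a (nontrivial)
  discrete valuation and has finite residue field.  The valuation is written
  multiplicatively, as an absolute value.
\<close>

definition valuation_ring :: "('a::field \<Rightarrow> real) \<Rightarrow> 'a ring" where
  "valuation_ring av = ring_of_type_algebra\<lparr>carrier := {x. av x \<le> 1}\<rparr>"

definition valuation_ideal :: "('a::field \<Rightarrow> real) \<Rightarrow> 'a set" where
  "valuation_ideal av = {x. av x < 1}"

definition residue_field :: "('a::field \<Rightarrow> real) \<Rightarrow> 'a set ring" where
  "residue_field av = valuation_ring av Quot valuation_ideal av"

text \<open>
  The characteristic of a ring is the additive order of its unit; \<open>group.ord\<close> is 0 for
  elements of infinite order.
\<close>

definition ring_characteristic :: "('a, 'b) ring_scheme \<Rightarrow> nat" where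
  "ring_characteristic R = group.ord (add_monoid R) \<one>\<^bsub>R\<^esub>"

definition residual_characteristic :: "('a::field \<Rightarrow> real) \<Rightarrow> nat" where
  "residual_characteristic av = ring_characteristic (residue_field av)"

locale nonarchimedean_local_field =
  fixes av :: "'a::field \<Rightarrow> real"
  assumes av_nonneg: "0 \<le> av x"
    and av_eq_0_iff: "av x = 0 \<longleftrightarrow> x = 0"
    and av_mult: "av (x * y) = av x * av y"
    and av_ultrametric: "av (x + y) \<le> max (av x) (av y)"
    and discrete: "\<exists>\<pi>. \<pi> \<noteq> 0 \<and> av \<pi> < 1 \<and> (\<forall>x. x \<noteq> 0 \<longrightarrow> (\<exists>k::int. av x = av \<pi> powi k))"
    and complete: "Metric_space.mcomplete UNIV (\<lambda>x y. av (x - y))"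
    and finite_residue_field: "finite (carrier (residue_field av))"


section \<open>Linear algebraic groups\<close>

text \<open>
  Let \<open>F\<close> be a field with algebraic closure \<open>K\<close>.  A linear algebraic \<open>F\<close>-group is a Zariski
  closed subgroup of \<open>GL\<^sub>n(K)\<close> that is defined over \<open>F\<close>, i.e. whose vanishing ideal is
  generated by polynomials with coefficients in \<open>F\<close>.  As usual \<open>GL\<^sub>n\<close> is an affine variety
  with coordinates the matrix entries together with the inverse of the determinant.
\<close>

datatype gl_coord = Entry nat nat | InvDet

type_synonym 'a gl_poly = "(gl_coord \<Rightarrow>\<^sub>0 nat) \<Rightarrow>\<^sub>0 'a"

definition gl_coords :: "nat \<Rightarrow> gl_coord set" where
  "gl_coords n = insert InvDet {Entry i j |i j. i < n \<and> j < n}"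

definition gl_polys :: "nat \<Rightarrow> 'a::zero gl_poly set" where
  "gl_polys n = {f. \<forall>m \<in> Poly_Mapping.keys f. Poly_Mapping.keys m \<subseteq> gl_coords n}"

primrec coord_value :: "'a::field mat \<Rightarrow> gl_coord \<Rightarrow> 'a" where
  "coord_value A (Entry i j) = A $$ (i, j)"
| "coord_value A InvDet = inverse (det A)"

definition gl_eval :: "'a::field mat \<Rightarrow> 'a gl_poly \<Rightarrow> 'a" where
  "gl_eval A f = (\<Sum>m \<in> Poly_Mapping.keys f. Poly_Mapping.lookup f m *
     (\<Prod>c \<in> Poly_Mapping.keys m. coord_value A c ^ Poly_Mapping.lookup m c))"

abbreviation GL :: "nat \<Rightarrow> 'a::field mat monoid" where
  "GL n \<equiv> units_of (ring_mat TYPE('a) n ())"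

definition zariski_closed_in_GL :: "nat \<Rightarrow> 'a::field mat set \<Rightarrow> bool" where
  "zariski_closed_in_GL n V \<longleftrightarrow>
     (\<exists>S. S \<subseteq> gl_polys n \<and> V = {A \<in> carrier (GL n). \<forall>f \<in> S. gl_eval A f = 0})"

definition vanishing_ideal :: "nat \<Rightarrow> 'a::field mat set \<Rightarrow> 'a gl_poly set" where
  "vanishing_ideal n V = {f \<in> gl_polys n. \<forall>A \<in> V. gl_eval A f = 0}"

definition rational_polys :: "'a::field alg_closure gl_poly set" where
  "rational_polys = {f. \<forall>m. Poly_Mapping.lookup f m \<in> range to_ac}"

definition defined_over_base :: "nat \<Rightarrow> 'a::field alg_closure mat set \<Rightarrow> bool" where
  "defined_over_base n V \<longleftrightarrow>
     (\<forall>f \<in> vanishing_ideal n V. \<exists>S q. finite S \<and> S \<subseteq> vanishing_ideal n V \<inter> rational_polys \<and>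
        (\<forall>s \<in> S. q s \<in> gl_polys n) \<and> f = (\<Sum>s \<in> S. q s * s))"

definition linear_algebraic_group :: "nat \<Rightarrow> 'a::field alg_closure mat set \<Rightarrow> bool" where
  "linear_algebraic_group n G \<longleftrightarrow>
     subgroup G (GL n) \<and> zariski_closed_in_GL n G \<and> defined_over_base n G"

definition rational_points :: "nat \<Rightarrow> 'a::field alg_closure mat set \<Rightarrow> 'a mat set" where
  "rational_points n G = {A \<in> carrier_mat n n. map_mat to_ac A \<in> G}"

definition unipotent :: "'a::comm_ring_1 mat \<Rightarrow> bool" where
  "unipotent A \<longleftrightarrow> square_mat A \<and>
     (\<exists>m. (A - 1\<^sub>m (dim_row A)) ^\<^sub>m m = 0\<^sub>m (dim_row A) (dim_row A))"

end

theory Submission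
  imports Defs "Jordan_Normal_Form.Char_Poly"
begin

text \<open>
  Let \<open>K\<close> be the algebraic closure of the local field \<open>F\<close> and \<open>\<pi>\<close> a uniformizer.  If \<open>h\<^sub>k\<close> is an \<open>n \<times> n\<close> matrix over \<open>F\<close> with \<open>h\<^sub>k ^ (p ^ k) = g\<close>, then every eigenvalue \<open>\<lambda>\<close> of
  \<open>g\<close> in \<open>K\<close> has the form \<open>\<mu>\<^sub>k ^ (p ^ k)\<close> with \<open>\<mu>\<^sub>k\<close> an eigenvalue of \<open>h\<^sub>k\<close>, and \<open>\<mu>\<^sub>k\<close> is a root
  of a monic polynomial of degree \<open>n\<close> over \<open>F\<close>.  The fields \<open>F(\<mu>\<^sub>k)\<close> may vary with \<open>k\<close>, and in
  positive characteristic there can be infinitely many of them, but the bound \<open>n\<close> on the degree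
  does not vary, and it controls everything that follows.

  The absolute value is extended to \<open>K\<close> in the form of a valuation subring \<open>V\<close> of \<open>K\<close> lying over
  the integers of \<open>F\<close>, obtained from Zorn's lemma
  (\<open>valued_field_extension_alg_closure_exists\<close>).  The relation "\<open>x\<close> is a multiple of \<open>y\<close> in \<open>V\<close>"
  then plays the part of \<open>|x| \<le> |y|\<close>.  In the relation \<open>f(x) = 0\<close> satisfied by a nonzero
  eigenvalue two terms must have the same size, so \<open>x ^ fact n\<close> has the size of an element of \<open>F\<close>
  (\<open>eigenvalue_fact_power_val_eq_base\<close>).  There are three consequences.

  \<^item> The size of \<open>\<lambda> ^ fact n\<close> is that of an integral power of \<open>\<pi>\<close> whose exponent is divisible by
    every \<open>p ^ k\<close>.  Hence \<open>\<lambda>\<close> and all \<open>\<mu>\<^sub>k\<close> are units of \<open>V\<close> (\<open>eigenvalue_power_roots_unit\<close>).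

  \<^item> Modulo the maximal ideal the powers of a unit \<open>\<mu>\<^sub>k\<close> fall into finitely many classes,
    and their number is bounded in terms of \<open>n\<close> and the residue field.  Hence
    \<open>\<mu>\<^sub>k ^ M = 1 + \<epsilon>\<^sub>k\<close> with \<open>\<epsilon>\<^sub>k\<close> in the maximal ideal, for some \<open>M\<close> independent of \<open>k\<close>
    (\<open>eigenvalue_unit_power_residue_one\<close>).

  \<^item> As \<open>\<epsilon>\<^sub>k\<close> is again an eigenvalue of an \<open>n \<times> n\<close> matrix over \<open>F\<close>, its power \<open>\<epsilon>\<^sub>k ^ fact n\<close> is a
    multiple of \<open>\<pi>\<close>.  Raising \<open>1 + \<epsilon>\<^sub>k\<close> to the \<open>p\<close>-th power \<open>k\<close> times brings it close to 1 at a
    rate that is uniform in \<open>k\<close> (\<open>one_plus_iterated_power\<close>), so \<open>(\<lambda> ^ M - 1) ^ fact n\<close> is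
    divisible by \<open>\<pi> ^ (k + 1)\<close> for every \<open>k\<close>.  This forces \<open>\<lambda> ^ M = 1\<close>
    (\<open>eigenvalue_power_roots_imp_root_of_unity\<close>).

  Consequently 0 is the only eigenvalue of \<open>g ^ M - 1\<close>, which is therefore nilpotent
  (\<open>only_eigenvalue_0_imp_nilpotent\<close>).
\<close>

section \<open>Valuation subrings of a field\<close>

definition closed_subring :: "'k::field set \<Rightarrow> bool" where
  "closed_subring S \<longleftrightarrow> 1 \<in> S \<and> (\<forall>x\<in>S. \<forall>y\<in>S. x + y \<in> S \<and> x * y \<in> S) \<and> (\<forall>x\<in>S. - x \<in> S)"

lemma closed_subringD:
  assumes "closed_subring S"
  shows "1 \<in> S" "0 \<in> S" "x \<in> S \<Longrightarrow> y \<in> S \<Longrightarrow> x + y \<in> S" "x \<in> S \<Longrightarrow> y \<in> S \<Longrightarrow> x * y \<in> S"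
    "x \<in> S \<Longrightarrow> - x \<in> S" "x \<in> S \<Longrightarrow> y \<in> S \<Longrightarrow> x - y \<in> S" "x \<in> S \<Longrightarrow> x ^ m \<in> S"
proof -
  show c: "1 \<in> S" "x \<in> S \<Longrightarrow> y \<in> S \<Longrightarrow> x + y \<in> S" "x \<in> S \<Longrightarrow> y \<in> S \<Longrightarrow> x * y \<in> S"
    "x \<in> S \<Longrightarrow> - x \<in> S" for x y
    using assms by (auto simp: closed_subring_def)
  show "0 \<in> S" using c(2)[OF c(1) c(4)[OF c(1)]] by simp
  show "x \<in> S \<Longrightarrow> y \<in> S \<Longrightarrow> x - y \<in> S" using c(2)[of x "- y"] c(4)[of y] by simp
  show "x \<in> S \<Longrightarrow> x ^ m \<in> S" by (induction m) (auto intro: c)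
qed

lemma closed_subring_sum:
  assumes "closed_subring S" "\<And>i. i \<in> I \<Longrightarrow> f i \<in> S"
  shows "sum f I \<in> S"
  using assms(2) by (induction I rule: infinite_finite_induct) (auto intro: closed_subringD[OF assms(1)])

text \<open>
  This is the ring \<open>S[x]\<close>.  Elements are presented as values of polynomials, because the argument
  below minimises the degree of such a presentation.
\<close>

definition adjoin :: "'k::field set \<Rightarrow> 'k \<Rightarrow> 'k set" where
  "adjoin S x = {poly a x |a. \<forall>i. poly.coeff a i \<in> S}"

lemma adjoinI: "(\<And>i. poly.coeff a i \<in> S) \<Longrightarrow> y = poly a x \<Longrightarrow> y \<in> adjoin S x"
  unfolding adjoin_def by blast

lemma subset_adjoin:
  assumes "closed_subring S"
  shows "S \<subseteq> adjoin S x"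
proof
  fix s assume "s \<in> S"
  then show "s \<in> adjoin S x"
    by (intro adjoinI[of "[:s:]"]) (auto simp: coeff_pCons closed_subringD[OF assms] split: nat.splits)
qed

lemma mem_adjoin:
  assumes "closed_subring S"
  shows "x \<in> adjoin S x"
  by (intro adjoinI[of "[:0, 1:]"]) (auto simp: coeff_pCons closed_subringD[OF assms] split: nat.splits)

lemma closed_subring_adjoin:
  assumes S: "closed_subring S"
  shows "closed_subring (adjoin S x)"
  unfolding closed_subring_def
proof (intro conjI ballI)
  show "1 \<in> adjoin S x"
    using subset_adjoin[OF S] closed_subringD(1)[OF S] by blast
  fix y assume "y \<in> adjoin S x"
  then obtain a where a: "\<And>i. poly.coeff a i \<in> S" "y = poly a x" unfolding adjoin_def by blast
  show "- y \<in> adjoin S x"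
    by (rule adjoinI[of "- a"]) (use a in \<open>auto intro: closed_subringD[OF S]\<close>)
  fix z assume "z \<in> adjoin S x"
  then obtain b where b: "\<And>i. poly.coeff b i \<in> S" "z = poly b x" unfolding adjoin_def by blast
  show "y + z \<in> adjoin S x"
    by (rule adjoinI[of "a + b"]) (use a b in \<open>auto intro: closed_subringD[OF S]\<close>)
  show "y * z \<in> adjoin S x"
    by (rule adjoinI[of "a * b"])
      (use a b in \<open>auto simp: coeff_mult intro!: closed_subring_sum[OF S] closed_subringD[OF S]\<close>)
qed

text \<open>
  The induction step of Chevalley's extension theorem.  Write \<open>b = b\<^sub>0 + \<dots> + b\<^sub>l X\<^sup>l\<close>.  In the
  relation \<open>1 = u b(1/x)\<close> the constant term can be moved to the left, where \<open>1 - u b\<^sub>0\<close> is a unit of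
  \<open>S\<close>.  Clearing denominators expresses \<open>x\<^sup>l\<close> by smaller powers of \<open>x\<close>, and this removes the
  leading term of \<open>a\<close>.
\<close>

lemma reduce_adjoin_degree:
  fixes S :: "'k::field set" and u x y :: 'k
  assumes S: "closed_subring S"
    and u: "u \<in> S"
    and unit: "\<And>s. s \<in> S \<Longrightarrow> inverse (1 - u * s) \<in> S \<and> 1 - u * s \<noteq> 0"
    and x: "x \<noteq> 0"
    and a: "\<And>i. poly.coeff a i \<in> S"
    and b: "\<And>i. poly.coeff b i \<in> S"
    and one: "1 = u * poly b (inverse x)"
    and deg: "degree b \<le> degree a" "degree b > 0"
  shows "\<exists>a'. (\<forall>i. poly.coeff a' i \<in> S) \<and> poly a' x = poly a x \<and> degree a' < degree a"
proof -
  define l m where "l = degree b" and "m = degree a"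
  define w where "w = inverse (1 - u * poly.coeff b 0)"
  have w: "w \<in> S" "w * (1 - u * poly.coeff b 0) = 1" using unit[OF b[of 0]] by (auto simp: w_def)
  \<comment> \<open>The polynomial with \<open>x\<^sup>l = u r(x)\<close>: the reversal of \<open>b\<close> without its constant term,
    divided by \<open>1 - u b\<^sub>0\<close>.\<close>
  define r where "r = (\<Sum>i=1..l. monom (w * poly.coeff b i) (l - i))"
  have rS: "poly.coeff r i \<in> S" for i
    unfolding r_def coeff_sum
    by (intro closed_subring_sum[OF S]) (auto intro!: closed_subringD[OF S] w b)
  have degr: "degree r < l"
  proof -
    have "degree r \<le> l - 1"
      unfolding r_def
      by (intro degree_sum_le) (auto intro!: order.trans[OF degree_monom_le])
    then show ?thesis using deg(2) unfolding l_def by linarith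
  qed
  have xl: "x ^ l = u * poly r x"
  proof -
    have pb: "poly b (inverse x) * x ^ l = poly.coeff b 0 * x ^ l + (\<Sum>i=1..l. poly.coeff b i * x ^ (l - i))"
    proof -
      have "poly b (inverse x) * x ^ l = (\<Sum>i\<le>l. poly.coeff b i * (inverse x ^ i * x ^ l))"
        unfolding poly_altdef l_def sum_distrib_right by (simp add: mult.assoc)
      also have "\<dots> = (\<Sum>i\<le>l. poly.coeff b i * x ^ (l - i))"
        by (intro sum.cong refl) (use x in \<open>auto simp: power_diff power_inverse field_simps\<close>)
      also have "{..l} = insert 0 {1..l}" by auto
      finally show ?thesis by (simp add: sum.insert)
    qed
    have "x ^ l = u * (poly b (inverse x) * x ^ l)" using one by (simp add: mult.assoc[symmetric])
    also have "\<dots> = u * poly.coeff b 0 * x ^ l + u * (\<Sum>i=1..l. poly.coeff b i * x ^ (l - i))"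
      unfolding pb by (simp add: algebra_simps)
    finally have "(1 - u * poly.coeff b 0) * x ^ l = u * (\<Sum>i=1..l. poly.coeff b i * x ^ (l - i))"
      by (simp add: algebra_simps)
    then have "w * (1 - u * poly.coeff b 0) * x ^ l = u * (w * (\<Sum>i=1..l. poly.coeff b i * x ^ (l - i)))"
      by (simp add: mult.assoc mult.left_commute)
    then have "x ^ l = u * (w * (\<Sum>i=1..l. poly.coeff b i * x ^ (l - i)))" unfolding w(2) by simp
    also have "w * (\<Sum>i=1..l. poly.coeff b i * x ^ (l - i)) = poly r x"
      unfolding r_def poly_sum poly_monom sum_distrib_left by (simp add: mult.assoc)
    finally show ?thesis .
  qed
  define c where "c = poly.coeff a m"
  define a' where "a' = a - monom c m + monom (u * c) (m - l) * r"
  have lm: "l \<le> m" "0 < l" using deg by (auto simp: l_def m_def)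
  have "degree (a - monom c m) < m"
  proof -
    have "degree (a - monom c m) \<le> m - 1"
    proof (rule degree_le, intro allI impI)
      fix i assume "m - 1 < i"
      then have "i = m \<or> i > m" by linarith
      then show "poly.coeff (a - monom c m) i = 0"
        by (auto simp: c_def m_def coeff_eq_0)
    qed
    then show ?thesis using lm by linarith
  qed
  moreover have "degree (monom (u * c) (m - l) * r) < m"
  proof -
    have "degree (monom (u * c) (m - l) * r) \<le> (m - l) + degree r"
      by (rule order.trans[OF degree_mult_le]) (simp add: degree_monom_le)
    then show ?thesis using degr lm by linarith
  qed
  ultimately have "degree a' < m" unfolding a'_def by (rule degree_add_less)
  moreover have "poly a' x = poly a x"
  proof -
    have "x ^ m = x ^ (m - l) * x ^ l" using lm by (simp add: power_add[symmetric])
    then have "x ^ m = x ^ (m - l) * (u * poly r x)" by (simp only: xl)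
    then show ?thesis unfolding a'_def by (simp add: poly_monom algebra_simps)
  qed
  moreover have "poly.coeff a' i \<in> S" for i
    unfolding a'_def coeff_add coeff_diff coeff_mult
    by (auto intro!: closed_subringD[OF S] closed_subring_sum[OF S] a rS u simp: c_def)
  ultimately show ?thesis unfolding m_def by blast
qed

text \<open>
  If neither \<open>x\<close> nor \<open>1/x\<close> lies in \<open>V\<close>, then by maximality \<open>1/u\<close> lies in both \<open>V[x]\<close> and \<open>V[1/x]\<close>.
  Of two presentations of least degree, \<open>reduce_adjoin_degree\<close> shortens the longer one.  The units
  which that lemma needs exist because \<open>1/u\<close> would otherwise also lie in \<open>V[1/(1 - us)]\<close>, and a
  common denominator \<open>(1 - us)\<^sup>m\<close> is congruent to 1 modulo \<open>u\<close>.
\<close>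

lemma maximal_avoiding_subring_total:
  fixes V :: "'k::field set"
  assumes V: "closed_subring V" and u: "u \<in> V" and nu: "inverse u \<notin> V"
    and max: "\<And>W. closed_subring W \<Longrightarrow> V \<subseteq> W \<Longrightarrow> inverse u \<notin> W \<Longrightarrow> W = V"
  shows "x \<in> V \<or> inverse x \<in> V"
proof (rule ccontr)
  assume neg: "\<not> (x \<in> V \<or> inverse x \<in> V)"
  note c = closed_subringD[OF V]
  have u0: "u \<noteq> 0" using nu c(2) by auto
  have adj: "inverse u \<in> adjoin V y" if "y \<notin> V" for y
    using max[OF closed_subring_adjoin[OF V] subset_adjoin[OF V], of y] mem_adjoin[OF V, of y] that
    by blast
  have unit: "inverse (1 - u * s) \<in> V \<and> 1 - u * s \<noteq> 0" if s: "s \<in> V" for s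
  proof (rule ccontr)
    let ?w = "1 - u * s"
    assume n: "\<not> (inverse ?w \<in> V \<and> ?w \<noteq> 0)"
    have w0: "?w \<noteq> 0"
    proof
      assume "?w = 0"
      then have "inverse u = s" using u0 by (simp add: field_simps)
      then show False using nu s by simp
    qed
    with n have "inverse u \<in> adjoin V (inverse ?w)" using adj by blast
    then obtain a where a: "\<And>i. poly.coeff a i \<in> V" "inverse u = poly a (inverse ?w)"
      unfolding adjoin_def by blast
    define m where "m = degree a"
    have wV: "?w \<in> V" by (intro c(1,4,6) u s)
    have "?w ^ m * inverse u = (\<Sum>i\<le>m. poly.coeff a i * (inverse ?w ^ i * ?w ^ m))"
      unfolding a(2) poly_altdef m_def sum_distrib_left by (simp add: algebra_simps)
    also have "\<dots> = (\<Sum>i\<le>m. poly.coeff a i * ?w ^ (m - i))"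
      by (intro sum.cong refl) (use w0 in \<open>auto simp: power_diff power_inverse field_simps\<close>)
    also have "\<dots> \<in> V" by (intro closed_subring_sum[OF V] c(4) c(7) a wV)
    finally have 1: "?w ^ m * inverse u \<in> V" .
    \<comment> \<open>Together with \<open>(1 - us)\<^sup>m / u \<in> V\<close> this puts \<open>1/u\<close> itself into \<open>V\<close>.\<close>
    have "\<exists>v\<in>V. ?w ^ k = 1 - u * v" for k
    proof (induction k)
      case 0 show ?case by (rule bexI[of _ 0]) (simp_all add: c(2))
    next
      case (Suc k)
      then obtain v where v: "v \<in> V" "?w ^ k = 1 - u * v" by blast
      have "?w ^ Suc k = 1 - u * (v + s - u * s * v)"
        unfolding power_Suc v(2) by (simp add: algebra_simps)
      moreover have "v + s - u * s * v \<in> V" by (intro c(3,4,6) v(1) s u)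
      ultimately show ?case by blast
    qed
    then obtain v where v: "v \<in> V" "?w ^ m = 1 - u * v" by blast
    have "inverse u = ?w ^ m * inverse u + v" unfolding v(2) using u0 by (simp add: field_simps)
    also have "\<dots> \<in> V" by (rule c(3)[OF 1 v(1)])
    finally show False using nu by simp
  qed
  define P where "P y a \<longleftrightarrow> (\<forall>i. poly.coeff a i \<in> V) \<and> poly a y = inverse u" for y and a :: "'k poly"
  define mindeg where "mindeg y a \<longleftrightarrow> P y a \<and> (\<forall>b. P y b \<longrightarrow> degree a \<le> degree b)" for y and a :: "'k poly"
  have ex: "\<exists>a. mindeg y a" if y: "y \<notin> V" for y
  proof -
    obtain a where "P y a" using adj[OF y] unfolding adjoin_def P_def by auto
    then show ?thesis unfolding mindeg_def by (rule ex_has_least_nat)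
  qed
  have main: False
    if y: "y \<noteq> 0" and a: "mindeg y a" and b: "mindeg (inverse y) b" and le: "degree b \<le> degree a"
    for y a b
  proof -
    have Pa: "P y a" and Pb: "P (inverse y) b" using a b unfolding mindeg_def by auto
    have "degree b > 0"
    proof (rule ccontr)
      assume "\<not> degree b > 0"
      then obtain s where "b = [:s:]" using degree_eq_zeroE by blast
      then show False using Pb nu unfolding P_def by (auto simp: coeff_pCons split: nat.splits)
    qed
    then have "\<exists>a'. (\<forall>i. poly.coeff a' i \<in> V) \<and> poly a' y = poly a y \<and> degree a' < degree a"
      using reduce_adjoin_degree[OF V u unit y, of a b] Pa Pb le u0 unfolding P_def by simp
    then obtain a' where "\<forall>i. poly.coeff a' i \<in> V" "poly a' y = poly a y" "degree a' < degree a"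
      by blast
    then have "P y a'" "degree a' < degree a" using Pa unfolding P_def by auto
    then show False using a unfolding mindeg_def using leD by blast
  qed
  have x0: "x \<noteq> 0" "inverse x \<noteq> 0" using neg c(2) by auto
  obtain a b where ab: "mindeg x a" "mindeg (inverse x) b"
    using ex[of x] ex[of "inverse x"] neg by auto
  show False
  proof (cases "degree b \<le> degree a")
    case True
    then show False by (rule main[OF x0(1) ab])
  next
    case False
    then have "degree a \<le> degree b" by simp
    then show False using main[OF x0(2) ab(2), of a] ab(1) by simp
  qed
qed

locale valuation_subring =
  fixes V :: "'k::field set"
  assumes closed: "closed_subring V"
    and total: "x \<in> V \<or> inverse x \<in> V"

text \<open>
  Chevalley's extension theorem, for a prescribed element \<open>u\<close> that must not become a unit.  Zorn's
  lemma yields a maximal subring avoiding \<open>1/u\<close>, and such a ring is a valuation subring.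
\<close>

theorem valuation_subring_extending:
  fixes S :: "'k::field set"
  assumes S: "closed_subring S" and u: "u \<in> S" and nu: "inverse u \<notin> S"
  shows "\<exists>V. valuation_subring V \<and> S \<subseteq> V \<and> inverse u \<notin> V"
proof -
  define A where "A = {W. closed_subring W \<and> S \<subseteq> W \<and> inverse u \<notin> W}"
  have "\<exists>M\<in>A. \<forall>W\<in>A. M \<subseteq> W \<longrightarrow> W = M"
  proof (rule subset_Zorn_nonempty)
    have "S \<in> A" using S nu by (simp add: A_def)
    then show "A \<noteq> {}" by blast
    fix C assume C: "C \<noteq> {}" "subset.chain A C"
    then have CA: "C \<subseteq> A" and lin: "\<And>Y Z. Y \<in> C \<Longrightarrow> Z \<in> C \<Longrightarrow> Y \<subseteq> Z \<or> Z \<subseteq> Y"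
      unfolding subset.chain_def by blast+
    have sub: "closed_subring Y" "S \<subseteq> Y" "inverse u \<notin> Y" if "Y \<in> C" for Y
      using subsetD[OF CA that] by (simp_all add: A_def)
    obtain Y0 where Y0: "Y0 \<in> C" using C(1) by blast
    have "closed_subring (\<Union>C)"
      unfolding closed_subring_def
    proof (intro conjI ballI)
      show "1 \<in> \<Union>C" using Y0 closed_subringD(1)[OF sub(1)[OF Y0]] by (rule UnionI)
      fix x assume "x \<in> \<Union>C"
      then obtain Y where Y: "Y \<in> C" "x \<in> Y" by blast
      show "- x \<in> \<Union>C" using Y(1) closed_subringD(5)[OF sub(1)[OF Y(1)] Y(2)] by (rule UnionI)
      fix y assume "y \<in> \<Union>C"
      then obtain Z where Z: "Z \<in> C" "y \<in> Z" by blast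
      obtain W where W: "W \<in> C" "x \<in> W" "y \<in> W" using lin[OF Y(1) Z(1)] Y Z by blast
      show "x + y \<in> \<Union>C" "x * y \<in> \<Union>C"
        using closed_subringD(3,4)[OF sub(1)[OF W(1)] W(2,3)] W(1) by blast+
    qed
    moreover have "S \<subseteq> \<Union>C" using sub(2)[OF Y0] Y0 by blast
    moreover have "inverse u \<notin> \<Union>C" using sub(3) by blast
    ultimately show "\<Union>C \<in> A" unfolding A_def by simp
  qed
  then obtain V where "V \<in> A" and max: "\<And>W. W \<in> A \<Longrightarrow> V \<subseteq> W \<Longrightarrow> W = V" by blast
  then have V: "closed_subring V" "S \<subseteq> V" "inverse u \<notin> V" by (simp_all add: A_def)
  have "x \<in> V \<or> inverse x \<in> V" for x
  proof (rule maximal_avoiding_subring_total[OF V(1) subsetD[OF V(2) u] V(3)])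
    fix W assume W: "closed_subring W" "V \<subseteq> W" "inverse u \<notin> W"
    have "S \<subseteq> W" using V(2) W(2) by (rule subset_trans)
    with W have "W \<in> A" by (simp add: A_def)
    then show "W = V" using W(2) by (rule max)
  qed
  with V have "valuation_subring V" by (simp add: valuation_subring_def)
  with V show ?thesis by blast
qed

section \<open>The preorder of a valuation subring\<close>

context valuation_subring
begin

text \<open>
  Divisibility in \<open>V\<close> is a total preorder on the field, compatible with multiplication and with
  addition in the ultrametric sense.  It replaces an absolute value extending the given one, so
  that no value group has to be constructed.
\<close>

definition val_le :: "'k \<Rightarrow> 'k \<Rightarrow> bool" (infix "\<preceq>\<^sub>v" 50) where
  "x \<preceq>\<^sub>v y \<longleftrightarrow> (\<exists>v\<in>V. x = v * y)"

definition val_less :: "'k \<Rightarrow> 'k \<Rightarrow> bool" (infix "\<prec>\<^sub>v" 50) where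
  "x \<prec>\<^sub>v y \<longleftrightarrow> \<not> y \<preceq>\<^sub>v x"

definition val_eq :: "'k \<Rightarrow> 'k \<Rightarrow> bool" (infix "\<approx>\<^sub>v" 50) where
  "x \<approx>\<^sub>v y \<longleftrightarrow> x \<preceq>\<^sub>v y \<and> y \<preceq>\<^sub>v x"

lemmas V_closed = closed_subringD[OF closed]

lemma val_le_refl [simp]: "x \<preceq>\<^sub>v x"
  unfolding val_le_def using V_closed(1) by force

lemma val_le_trans [trans]: "x \<preceq>\<^sub>v y \<Longrightarrow> y \<preceq>\<^sub>v z \<Longrightarrow> x \<preceq>\<^sub>v z"
  unfolding val_le_def
proof (elim bexE)
  fix v w assume "v \<in> V" "x = v * y" "w \<in> V" "y = w * z"
  then show "\<exists>v\<in>V. x = v * z"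
    by (intro bexI[of _ "v * w"] V_closed(4)) (simp_all add: mult.assoc)
qed

lemma zero_val_le [simp]: "0 \<preceq>\<^sub>v x"
  unfolding val_le_def using V_closed(2) by force

lemma val_le_zero_iff [simp]: "x \<preceq>\<^sub>v 0 \<longleftrightarrow> x = 0"
  unfolding val_le_def using V_closed(2) by force

lemma val_le_one_iff: "x \<preceq>\<^sub>v 1 \<longleftrightarrow> x \<in> V"
  unfolding val_le_def by simp

lemma val_le_divide_iff: "y \<noteq> 0 \<Longrightarrow> x \<preceq>\<^sub>v y \<longleftrightarrow> x / y \<in> V"
  unfolding val_le_def by (metis nonzero_eq_divide_eq)

lemma val_le_total: "x \<preceq>\<^sub>v y \<or> y \<preceq>\<^sub>v x"
proof (cases "x = 0 \<or> y = 0")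
  case False
  then show ?thesis using total[of "x / y"] by (simp add: val_le_divide_iff)
qed auto

lemma val_le_add: "x \<preceq>\<^sub>v z \<Longrightarrow> y \<preceq>\<^sub>v z \<Longrightarrow> x + y \<preceq>\<^sub>v z"
  unfolding val_le_def
proof (elim bexE)
  fix v w assume "v \<in> V" "x = v * z" "w \<in> V" "y = w * z"
  then show "\<exists>v\<in>V. x + y = v * z"
    by (intro bexI[of _ "v + w"] V_closed(3)) (simp_all add: distrib_right)
qed

lemma val_le_mult: "x \<preceq>\<^sub>v y \<Longrightarrow> x' \<preceq>\<^sub>v y' \<Longrightarrow> x * x' \<preceq>\<^sub>v y * y'"
proof -
  assume "x \<preceq>\<^sub>v y" "x' \<preceq>\<^sub>v y'"
  then obtain v v' where "v \<in> V" "x = v * y" "v' \<in> V" "x' = v' * y'" unfolding val_le_def by blast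
  then show ?thesis
    unfolding val_le_def by (intro bexI[of _ "v * v'"] V_closed(4)) simp_all
qed

lemma val_le_minus_iff [simp]: "- x \<preceq>\<^sub>v y \<longleftrightarrow> x \<preceq>\<^sub>v y"
proof -
  have "- a \<preceq>\<^sub>v y" if "a \<preceq>\<^sub>v y" for a
    using val_le_mult[of "- 1" 1 a y] that val_le_one_iff[of "- 1"] V_closed(5)[OF V_closed(1)] by simp
  from this[of x] this[of "- x"] show ?thesis by auto
qed

lemma val_le_power: "x \<preceq>\<^sub>v y \<Longrightarrow> x ^ m \<preceq>\<^sub>v y ^ m"
  by (induction m) (simp_all add: val_le_mult)

lemma val_le_mult_cancel: "c \<noteq> 0 \<Longrightarrow> c * x \<preceq>\<^sub>v c * y \<longleftrightarrow> x \<preceq>\<^sub>v y"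
  unfolding val_le_def by (auto simp: mult.left_commute)

lemma val_le_sum: "(\<And>i. i \<in> I \<Longrightarrow> f i \<preceq>\<^sub>v z) \<Longrightarrow> sum f I \<preceq>\<^sub>v z"
  by (induction I rule: infinite_finite_induct) (simp_all add: val_le_add)

lemma val_less_imp_le: "x \<prec>\<^sub>v y \<Longrightarrow> x \<preceq>\<^sub>v y"
  using val_le_total unfolding val_less_def by blast

lemma val_le_less_trans: "x \<preceq>\<^sub>v y \<Longrightarrow> y \<prec>\<^sub>v z \<Longrightarrow> x \<prec>\<^sub>v z"
  unfolding val_less_def by (blast intro: val_le_trans)

lemma zero_val_less_iff [simp]: "0 \<prec>\<^sub>v x \<longleftrightarrow> x \<noteq> 0"
  unfolding val_less_def by simp

lemma val_less_add: "x \<prec>\<^sub>v z \<Longrightarrow> y \<prec>\<^sub>v z \<Longrightarrow> x + y \<prec>\<^sub>v z"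
proof (cases "x \<preceq>\<^sub>v y")
  case True
  assume "y \<prec>\<^sub>v z"
  then show ?thesis by (rule val_le_less_trans[OF val_le_add[OF True val_le_refl]])
next
  case False
  assume "x \<prec>\<^sub>v z"
  moreover have "y \<preceq>\<^sub>v x" using False val_le_total by blast
  ultimately show ?thesis using val_le_less_trans[OF val_le_add[OF val_le_refl]] by blast
qed

lemma val_less_minus_iff [simp]: "- x \<prec>\<^sub>v y \<longleftrightarrow> x \<prec>\<^sub>v y"
proof -
  have "y \<preceq>\<^sub>v - a" if "y \<preceq>\<^sub>v a" for a
    using val_le_mult[of "- 1" 1 "- y" "- a"] that val_le_minus_iff[of "- y" "- a"]
      val_le_mult[of "- 1" "- 1" y a] by simp
  from this[of x] this[of "- x"] have "y \<preceq>\<^sub>v - x \<longleftrightarrow> y \<preceq>\<^sub>v x" by auto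
  then show ?thesis by (simp add: val_less_def)
qed

lemma val_less_diff: "x \<prec>\<^sub>v z \<Longrightarrow> y \<prec>\<^sub>v z \<Longrightarrow> x - y \<prec>\<^sub>v z"
  using val_less_add[of x z "- y"] by simp

lemma val_less_sum: "z \<noteq> 0 \<Longrightarrow> (\<And>i. i \<in> I \<Longrightarrow> f i \<prec>\<^sub>v z) \<Longrightarrow> sum f I \<prec>\<^sub>v z"
  by (induction I rule: infinite_finite_induct) (simp_all add: val_less_add)

lemma val_less_mult: "x \<prec>\<^sub>v y \<Longrightarrow> x' \<prec>\<^sub>v y' \<Longrightarrow> x * x' \<prec>\<^sub>v y * y'"
proof -
  assume a: "x \<prec>\<^sub>v y" "x' \<prec>\<^sub>v y'"
  then have y: "y \<noteq> 0" by (auto simp: val_less_def)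
  have "y * x' \<prec>\<^sub>v y * y'" using a(2) y by (simp add: val_less_def val_le_mult_cancel)
  moreover have "x * x' \<preceq>\<^sub>v y * x'" by (rule val_le_mult[OF val_less_imp_le[OF a(1)] val_le_refl])
  ultimately show ?thesis using val_le_less_trans by metis
qed

lemma val_less_power: "x \<prec>\<^sub>v y \<Longrightarrow> m > 0 \<Longrightarrow> x ^ m \<prec>\<^sub>v y ^ m"
proof (induction m)
  case (Suc m)
  then show ?case by (cases "m = 0") (simp_all add: val_less_mult)
qed simp

lemma val_le_power_iff: "m > 0 \<Longrightarrow> x ^ m \<preceq>\<^sub>v y ^ m \<longleftrightarrow> x \<preceq>\<^sub>v y"
  using val_le_power[of x y m] val_less_power[of y x m] unfolding val_less_def by blast

lemma val_eq_power_iff: "m > 0 \<Longrightarrow> x ^ m \<approx>\<^sub>v y ^ m \<longleftrightarrow> x \<approx>\<^sub>v y"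
  unfolding val_eq_def by (simp add: val_le_power_iff)

lemma val_eq_power: "x \<approx>\<^sub>v y \<Longrightarrow> x ^ m \<approx>\<^sub>v y ^ m"
  unfolding val_eq_def by (simp add: val_le_power)

lemma val_eq_trans: "x \<approx>\<^sub>v y \<Longrightarrow> y \<approx>\<^sub>v z \<Longrightarrow> x \<approx>\<^sub>v z"
  unfolding val_eq_def by (blast intro: val_le_trans)

lemma val_eq_sym: "x \<approx>\<^sub>v y \<Longrightarrow> y \<approx>\<^sub>v x"
  unfolding val_eq_def by blast

lemma finite_has_val_greatest:
  assumes "finite I" "I \<noteq> {}"
  shows "\<exists>i\<in>I. \<forall>j\<in>I. f j \<preceq>\<^sub>v f i"
  using assms
proof (induction I rule: finite_ne_induct)
  case (insert k I)
  then obtain i where i: "i \<in> I" "\<forall>j\<in>I. f j \<preceq>\<^sub>v f i" by blast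
  show ?case
  proof (cases "f k \<preceq>\<^sub>v f i")
    case True
    then show ?thesis using i by auto
  next
    case False
    then have "f i \<preceq>\<^sub>v f k" using val_le_total by blast
    have "f j \<preceq>\<^sub>v f k" if "j \<in> I" for j
      using val_le_trans[OF bspec[OF i(2) that] \<open>f i \<preceq>\<^sub>v f k\<close>] .
    then show ?thesis by (intro bexI[of _ k]) simp_all
  qed
qed auto

text \<open>
  The principle behind Newton polygons: a single term that strictly dominates all others cannot
  cancel.
\<close>

lemma vanishing_sum_two_dominant:
  assumes fin: "finite I" and sum: "sum f I = 0" and nz: "k \<in> I" "f k \<noteq> 0"
  shows "\<exists>i\<in>I. \<exists>j\<in>I. i \<noteq> j \<and> f i \<noteq> 0 \<and> f i \<approx>\<^sub>v f j"
proof -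
  obtain i where i: "i \<in> I" "\<And>j. j \<in> I \<Longrightarrow> f j \<preceq>\<^sub>v f i"
    using finite_has_val_greatest[of I f] fin nz(1) by blast
  have fi: "f i \<noteq> 0" using i(2)[OF nz(1)] nz(2) by auto
  show ?thesis
  proof (rule ccontr)
    assume no: "\<not> ?thesis"
    have "f j \<prec>\<^sub>v f i" if "j \<in> I - {i}" for j
    proof -
      have "\<not> f i \<approx>\<^sub>v f j" using no that i(1) fi by auto
      then show ?thesis using i(2)[of j] that unfolding val_eq_def val_less_def by simp
    qed
    then have "sum f (I - {i}) \<prec>\<^sub>v f i" using fi by (intro val_less_sum)
    moreover have "sum f (I - {i}) = - f i"
      using sum by (simp add: sum_diff1 fin i(1))
    ultimately have "f i \<prec>\<^sub>v f i" by simp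
    then show False by (simp add: val_less_def)
  qed
qed

lemma one_plus_power_expansion:
  assumes "e \<preceq>\<^sub>v 1"
  shows "(1 + e) ^ m - 1 - of_nat m * e \<preceq>\<^sub>v e ^ 2"
proof -
  have e: "e \<in> V" using assms by (simp add: val_le_one_iff)
  have "\<exists>v\<in>V. (1 + e) ^ m = 1 + of_nat m * e + v * e ^ 2"
  proof (induction m)
    case 0
    show ?case by (rule bexI[of _ 0]) (simp_all add: V_closed(2))
  next
    case (Suc m)
    then obtain v where v: "v \<in> V" "(1 + e) ^ m = 1 + of_nat m * e + v * e ^ 2" by blast
    have "of_nat m \<in> V" by (induction m) (simp_all add: V_closed)
    then have "of_nat m + v + v * e \<in> V" using v(1) e by (intro V_closed(3,4))
    moreover have "(1 + e) ^ Suc m = 1 + of_nat (Suc m) * e + (of_nat m + v + v * e) * e ^ 2"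
      unfolding power_Suc v(2) by (simp add: algebra_simps power2_eq_square)
    ultimately show ?case by blast
  qed
  then obtain v where "v \<in> V" "(1 + e) ^ m = 1 + of_nat m * e + v * e ^ 2" by blast
  then show ?thesis unfolding val_le_def by (intro bexI[of _ v]) simp_all
qed

text \<open>
  Write \<open>1 + d\<close> for \<open>(1 + e) ^ (p ^ k)\<close>.  One more \<open>p\<close>-th power replaces \<open>d\<close> by \<open>p d\<close> plus a multiple
  of \<open>d\<^sup>2\<close>, and both gain a factor \<open>t\<close> since \<open>p\<close> and \<open>d\<close> are multiples of \<open>t\<close>.
\<close>

lemma one_plus_iterated_power:
  assumes e: "e \<preceq>\<^sub>v t" and p: "of_nat p \<preceq>\<^sub>v t" and t: "t \<preceq>\<^sub>v 1"
  shows "(1 + e) ^ (p ^ k) - 1 \<preceq>\<^sub>v t ^ Suc k"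
proof (induction k)
  case 0
  show ?case using e by simp
next
  case (Suc k)
  define d where "d = (1 + e) ^ (p ^ k) - 1"
  have d: "d \<preceq>\<^sub>v t ^ Suc k" using Suc unfolding d_def .
  have "t ^ Suc k \<preceq>\<^sub>v 1" using val_le_power[OF t, of "Suc k"] by simp
  with d have d1: "d \<preceq>\<^sub>v 1" by (rule val_le_trans)
  have tk: "t ^ Suc k \<preceq>\<^sub>v t"
    using val_le_mult[OF val_le_refl[of t] val_le_power[OF t, of k]] by simp
  have "of_nat p * d \<preceq>\<^sub>v t ^ Suc (Suc k)"
    using val_le_mult[OF p d] by simp
  moreover have "d ^ 2 \<preceq>\<^sub>v t ^ Suc (Suc k)"
    using val_le_mult[OF val_le_trans[OF d tk] d] by (simp add: power2_eq_square)
  then have "(1 + d) ^ p - 1 - of_nat p * d \<preceq>\<^sub>v t ^ Suc (Suc k)"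
    by (rule val_le_trans[OF one_plus_power_expansion[OF d1]])
  ultimately have "((1 + d) ^ p - 1 - of_nat p * d) + of_nat p * d \<preceq>\<^sub>v t ^ Suc (Suc k)"
    by (intro val_le_add)
  moreover have "((1 + d) ^ p - 1 - of_nat p * d) + of_nat p * d = (1 + e) ^ (p ^ Suc k) - 1"
    by (simp add: d_def power_mult[symmetric] mult.commute)
  ultimately show ?case by simp
qed

end

section \<open>Non-Archimedean local fields\<close>

context nonarchimedean_local_field
begin

lemma av_zero [simp]: "av 0 = 0"
  by (simp add: av_eq_0_iff)

lemma av_pos_iff: "0 < av x \<longleftrightarrow> x \<noteq> 0"
  using av_nonneg[of x] av_eq_0_iff[of x] by auto

lemma av_one [simp]: "av 1 = 1"
proof -
  have "av 1 * av 1 = av 1 * 1" using av_mult[of 1 1] by simp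
  then show ?thesis using av_eq_0_iff[of 1] by simp
qed

lemma av_power: "av (x ^ m) = av x ^ m"
  by (induction m) (auto simp: av_mult)

lemma av_inverse: "av (inverse x) = inverse (av x)"
proof (cases "x = 0")
  case False
  then have "av x * av (inverse x) = 1" by (simp flip: av_mult)
  then show ?thesis by (metis inverse_unique)
qed simp

lemma av_divide: "av (x / y) = av x / av y"
  by (simp add: divide_inverse av_mult av_inverse)

lemma av_minus [simp]: "av (- x) = av x"
proof -
  have "av (- 1) ^ 2 = 1" by (simp flip: av_power)
  then have "av (- 1) = 1" using av_nonneg[of "- 1"] by (simp add: power2_eq_1_iff)
  then show ?thesis using av_mult[of "- 1" x] by simp
qed

lemma uniformizer_exists:
  "\<exists>\<pi>. \<pi> \<noteq> 0 \<and> av \<pi> < 1 \<and> (\<forall>x. x \<noteq> 0 \<longrightarrow> (\<exists>s::int. av x = av \<pi> powi s))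
    \<and> (\<forall>x. av x < 1 \<longrightarrow> av x \<le> av \<pi>)"
proof -
  obtain \<pi> where \<pi>: "\<pi> \<noteq> 0" "av \<pi> < 1" "\<And>x. x \<noteq> 0 \<Longrightarrow> \<exists>s::int. av x = av \<pi> powi s"
    using discrete by blast
  have \<pi>_pos: "0 < av \<pi>" using \<pi>(1) by (simp add: av_pos_iff)
  have "av x \<le> av \<pi>" if "av x < 1" for x
  proof (cases "x = 0")
    case False
    then obtain s where s: "av x = av \<pi> powi s" using \<pi>(3) by blast
    have "0 < s"
    proof (rule ccontr)
      assume "\<not> 0 < s"
      then have "av \<pi> powi 0 \<le> av \<pi> powi s" using \<pi>_pos \<pi>(2) by (intro power_int_decreasing) auto
      then show False using that s by simp
    qed
    then have "av \<pi> powi s \<le> av \<pi> powi 1" using \<pi>_pos \<pi>(2) by (intro power_int_decreasing) auto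
    then show ?thesis using s by simp
  qed (use \<pi>_pos in simp)
  then show ?thesis using \<pi> by blast
qed

lemma integers_closed_subring: "closed_subring {x. av x \<le> 1}"
proof -
  have "av (x + y) \<le> 1" if "av x \<le> 1" "av y \<le> 1" for x y
    using av_ultrametric[of x y] that by linarith
  moreover have "av (x * y) \<le> 1" if "av x \<le> 1" "av y \<le> 1" for x y
    using that av_nonneg by (simp add: av_mult mult_le_one)
  ultimately show ?thesis unfolding closed_subring_def by simp
qed

lemma valuation_ring_simps [simp]:
  "carrier (valuation_ring av) = {x. av x \<le> 1}"
  "x \<oplus>\<^bsub>valuation_ring av\<^esub> y = x + y" "x \<otimes>\<^bsub>valuation_ring av\<^esub> y = x * y"
  "\<zero>\<^bsub>valuation_ring av\<^esub> = 0" "\<one>\<^bsub>valuation_ring av\<^esub> = 1"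
  by (simp_all add: valuation_ring_def ring_of_type_algebra_def)

lemma valuation_ring_is_cring: "cring (valuation_ring av)"
proof -
  note c = closed_subringD[OF integers_closed_subring]
  show ?thesis
  proof (intro cringI abelian_groupI comm_monoidI)
    fix x assume x: "x \<in> carrier (valuation_ring av)"
    show "\<exists>y\<in>carrier (valuation_ring av). y \<oplus>\<^bsub>valuation_ring av\<^esub> x = \<zero>\<^bsub>valuation_ring av\<^esub>"
      using x by (intro bexI[of _ "- x"]) simp_all
  qed (use c in \<open>simp_all add: algebra_simps\<close>)
qed

lemma valuation_ideal_is_ideal: "ideal (valuation_ideal av) (valuation_ring av)"
proof -
  interpret cring "valuation_ring av" by (rule valuation_ring_is_cring)
  have minus: "\<ominus>\<^bsub>valuation_ring av\<^esub> x = - x" if "av x \<le> 1" for x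
    using that by (intro minus_equality) simp_all
  show ?thesis
  proof (intro idealI subgroup.intro)
    show "ring (valuation_ring av)" by (rule ring_axioms)
    show "valuation_ideal av \<subseteq> carrier (add_monoid (valuation_ring av))"
      by (auto simp: valuation_ideal_def)
    show "x \<otimes>\<^bsub>add_monoid (valuation_ring av)\<^esub> y \<in> valuation_ideal av"
      if "x \<in> valuation_ideal av" "y \<in> valuation_ideal av" for x y
      using that av_ultrametric[of x y] by (auto simp: valuation_ideal_def)
    show "\<one>\<^bsub>add_monoid (valuation_ring av)\<^esub> \<in> valuation_ideal av"
      by (simp add: valuation_ideal_def)
    show "inv\<^bsub>add_monoid (valuation_ring av)\<^esub> x \<in> valuation_ideal av"
      if "x \<in> valuation_ideal av" for x
      using that minus[of x] by (simp add: valuation_ideal_def a_inv_def)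
    show "x \<otimes>\<^bsub>valuation_ring av\<^esub> a \<in> valuation_ideal av" "a \<otimes>\<^bsub>valuation_ring av\<^esub> x \<in> valuation_ideal av"
      if "a \<in> valuation_ideal av" "x \<in> carrier (valuation_ring av)" for a x
      using that mult_less_le_imp_less[of "av a" 1 "av x" 1] av_nonneg[of a] av_nonneg[of x]
        mult_left_le[of "av x" "av a"]
      by (auto simp: valuation_ideal_def av_mult mult.commute)
  qed
qed

lemma residue_coset_eq_iff:
  assumes "av x \<le> 1" "av y \<le> 1"
  shows "valuation_ideal av +>\<^bsub>valuation_ring av\<^esub> x = valuation_ideal av +>\<^bsub>valuation_ring av\<^esub> y
    \<longleftrightarrow> av (x - y) < 1"
proof -
  interpret ideal "valuation_ideal av" "valuation_ring av" by (rule valuation_ideal_is_ideal)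
  have "x \<ominus>\<^bsub>valuation_ring av\<^esub> y = x - y"
    using assms minus_equality[of "- y" y] by (simp add: a_minus_def)
  then show ?thesis
    using quotient_eq_iff_same_a_r_cos[OF valuation_ideal_is_ideal, of x y] assms
    by (simp add: valuation_ideal_def)
qed

text \<open>
  Finiteness of the residue field in terms of elements instead of cosets, as needed for counting
  residues of algebraic elements.
\<close>

lemma finite_residue_representatives:
  "\<exists>R. finite R \<and> R \<noteq> {} \<and> (\<forall>x. av x \<le> 1 \<longrightarrow> (\<exists>r\<in>R. av (x - r) < 1))"
proof -
  let ?c = "\<lambda>x. valuation_ideal av +>\<^bsub>valuation_ring av\<^esub> x"
  have "?c ` {x. av x \<le> 1} = carrier (residue_field av)"
    unfolding residue_field_def FactRing_def A_RCOSETS_def' by auto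
  then have "finite (?c ` {x. av x \<le> 1})" using finite_residue_field by simp
  then obtain R where R: "R \<subseteq> {x. av x \<le> 1}" "finite R" "?c ` {x. av x \<le> 1} = ?c ` R"
    using finite_subset_image[of "?c ` {x. av x \<le> 1}" ?c "{x. av x \<le> 1}"] by auto
  have "\<exists>r\<in>R. av (x - r) < 1" if "av x \<le> 1" for x
  proof -
    have "?c x \<in> ?c ` R" using that R(3) by auto
    then obtain r where "r \<in> R" "?c x = ?c r" by auto
    then show ?thesis using residue_coset_eq_iff[OF that, of r] R(1) by auto
  qed
  moreover from this[of 0] have "R \<noteq> {}" by auto
  ultimately show ?thesis using R(1,2) by (intro exI[of _ R]) auto
qed

text \<open>
  The order of the unit of a nontrivial finite ring is at least 2, and \<open>p\<close> times the unit vanishes.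
\<close>

lemma residual_characteristic_bounds:
  assumes p: "p = residual_characteristic av"
  shows "2 \<le> p" "av (of_nat p) < 1"
proof -
  let ?R = "residue_field av" and ?c = "\<lambda>x. valuation_ideal av +>\<^bsub>valuation_ring av\<^esub> x"
  interpret ideal "valuation_ideal av" "valuation_ring av" by (rule valuation_ideal_is_ideal)
  interpret Q: ring ?R unfolding residue_field_def by (rule quotient_is_ring)
  interpret h: ring_hom_ring "valuation_ring av" ?R ?c
    unfolding residue_field_def by (rule rcos_ring_hom_ring)
  have one: "\<one>\<^bsub>?R\<^esub> = ?c 1" and zero: "\<zero>\<^bsub>?R\<^esub> = ?c 0"
    using h.hom_one h.hom_zero by simp_all
  have p_eq: "p = Q.add.ord \<one>\<^bsub>?R\<^esub>"
    unfolding p residual_characteristic_def ring_characteristic_def ..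
  have int_nat: "av (of_nat m) \<le> 1" for m
    using closed_subringD[OF integers_closed_subring] by (induction m) simp_all
  have pow: "[m] \<cdot>\<^bsub>?R\<^esub> \<one>\<^bsub>?R\<^esub> = ?c (of_nat m)" for m :: nat
  proof (induction m)
    case 0
    then show ?case by (simp add: zero)
  next
    case (Suc m)
    have "?c (of_nat m + 1) = ?c (of_nat m) \<oplus>\<^bsub>?R\<^esub> ?c 1"
      using h.hom_add[of "of_nat m" 1] int_nat[of m] by simp
    then show ?case using Suc by (simp add: one add.commute)
  qed
  have "[p] \<cdot>\<^bsub>?R\<^esub> \<one>\<^bsub>?R\<^esub> = \<zero>\<^bsub>?R\<^esub>"
    unfolding p_eq using Q.add.pow_ord_eq_1[of "\<one>\<^bsub>?R\<^esub>"] by simp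
  then have "?c (of_nat p) = ?c 0" unfolding pow zero .
  then show "av (of_nat p) < 1" using residue_coset_eq_iff[OF int_nat, of 0 p] by simp
  have "p \<noteq> 0"
    unfolding p_eq using group.ord_ge_1[OF Q.add.is_group, of "\<one>\<^bsub>?R\<^esub>"] finite_residue_field by simp
  moreover have "p \<noteq> 1" using \<open>av (of_nat p) < 1\<close> by auto
  ultimately show "2 \<le> p" by linarith
qed

end

section \<open>Eigenvalues of powers and nilpotent matrices\<close>

lemma (in comm_ring_hom) map_mat_pow_minus_one:
  assumes A: "A \<in> carrier_mat n n"
  shows "map_mat hom (A ^\<^sub>m m - 1\<^sub>m n) = map_mat hom A ^\<^sub>m m - 1\<^sub>m n"
proof -
  have "map_mat hom (A ^\<^sub>m m - 1\<^sub>m n) = map_mat hom (A ^\<^sub>m m) - map_mat hom (1\<^sub>m n)"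
    using A by (intro eq_matI) (simp_all add: hom_minus)
  then show ?thesis using A by (simp add: mat_hom_pow mat_hom_one)
qed

lemma eigenvalue_minus_one_iff:
  fixes A :: "'k::field mat"
  assumes A: "A \<in> carrier_mat n n"
  shows "eigenvalue (A - 1\<^sub>m n) x \<longleftrightarrow> eigenvalue A (x + 1)"
proof -
  have A1: "A - 1\<^sub>m n \<in> carrier_mat n n" by (rule minus_carrier_mat) simp
  have "char_matrix (A - 1\<^sub>m n) x = char_matrix A (x + 1)"
    unfolding char_matrix_def using A by (intro eq_matI) auto
  then show ?thesis unfolding eigenvalue_det[OF A] eigenvalue_det[OF A1] by simp
qed

lemma eigenvalue_pow:
  fixes A :: "'k::field mat"
  assumes A: "A \<in> carrier_mat n n" and ev: "eigenvalue A x"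
  shows "eigenvalue (A ^\<^sub>m m) (x ^ m)"
proof -
  obtain v where v: "eigenvector A v x" using ev unfolding eigenvalue_def by blast
  have "A ^\<^sub>m m *\<^sub>v v = x ^ m \<cdot>\<^sub>v v" by (rule eigenvector_pow[OF A v])
  then have "eigenvector (A ^\<^sub>m m) v (x ^ m)"
    using v A unfolding eigenvector_def by (simp add: carrier_matD(1)[OF pow_carrier_mat[OF A]])
  then show ?thesis unfolding eigenvalue_def by blast
qed

text \<open>
  This is \<open>f(A) v\<close> in Horner form, which follows the recursion of polynomials on \<open>pCons\<close>.
\<close>

definition poly_apply :: "'k::field mat \<Rightarrow> 'k poly \<Rightarrow> 'k vec \<Rightarrow> 'k vec" where
  "poly_apply A f v = fold_coeffs (\<lambda>c w. c \<cdot>\<^sub>v v + A *\<^sub>v w) f (0\<^sub>v (dim_vec v))"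

context
  fixes A :: "'k::field mat" and n :: nat
  assumes A: "A \<in> carrier_mat n n"
begin

lemma mult_zero_vec: "A *\<^sub>v 0\<^sub>v n = 0\<^sub>v n"
  using A by (intro eq_vecI) auto

lemma poly_apply_zero: "v \<in> carrier_vec n \<Longrightarrow> poly_apply A 0 v = 0\<^sub>v n"
  by (simp add: poly_apply_def)

lemma poly_apply_pCons:
  assumes v: "v \<in> carrier_vec n"
  shows "poly_apply A (pCons c f) v = c \<cdot>\<^sub>v v + A *\<^sub>v poly_apply A f v"
proof (cases "c = 0 \<and> f = 0")
  case True
  then show ?thesis using v A mult_zero_vec by (auto simp: poly_apply_def)
next
  case False
  then show ?thesis by (auto simp: poly_apply_def)
qed

lemma poly_apply_carrier:
  assumes v: "v \<in> carrier_vec n"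
  shows "poly_apply A f v \<in> carrier_vec n"
  by (induction f) (use A v in \<open>auto simp: poly_apply_zero poly_apply_pCons\<close>)

lemma poly_apply_add:
  assumes v: "v \<in> carrier_vec n"
  shows "poly_apply A (f + g) v = poly_apply A f v + poly_apply A g v"
proof (induction f g rule: poly_induct2)
  case 0
  then show ?case using v by (simp add: poly_apply_zero)
next
  case (pCons a f b g)
  note c = poly_apply_carrier[OF v]
  have "A *\<^sub>v (poly_apply A f v + poly_apply A g v) = A *\<^sub>v poly_apply A f v + A *\<^sub>v poly_apply A g v"
    by (rule mult_add_distrib_mat_vec[OF A c c])
  moreover have "A *\<^sub>v poly_apply A f v \<in> carrier_vec n" "A *\<^sub>v poly_apply A g v \<in> carrier_vec n"
    using A c by auto
  ultimately show ?case
    using v pCons by (intro eq_vecI) (simp_all add: poly_apply_pCons[OF v] carrier_matD[OF A] algebra_simps)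
qed

lemma poly_apply_smult:
  assumes v: "v \<in> carrier_vec n"
  shows "poly_apply A (smult a f) v = a \<cdot>\<^sub>v poly_apply A f v"
proof (induction f)
  case 0
  then show ?case using v by (intro eq_vecI) (simp_all add: poly_apply_zero)
next
  case (pCons c f)
  have f: "poly_apply A f v \<in> carrier_vec n" by (rule poly_apply_carrier[OF v])
  have "A *\<^sub>v (a \<cdot>\<^sub>v poly_apply A f v) = a \<cdot>\<^sub>v (A *\<^sub>v poly_apply A f v)"
    by (rule mult_mat_vec[OF A f])
  moreover have "A *\<^sub>v poly_apply A f v \<in> carrier_vec n" using A f by auto
  ultimately show ?case
    using v pCons by (intro eq_vecI) (simp_all add: poly_apply_pCons[OF v] carrier_matD[OF A] algebra_simps)
qed

lemma poly_apply_mult: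
  assumes v: "v \<in> carrier_vec n"
  shows "poly_apply A (f * g) v = poly_apply A f (poly_apply A g v)"
proof (induction f)
  case 0
  then show ?case using v by (simp add: poly_apply_zero poly_apply_carrier)
next
  case (pCons c f)
  note c = poly_apply_carrier[OF v]
  have "poly_apply A (pCons c f * g) v
      = c \<cdot>\<^sub>v poly_apply A g v + (0 \<cdot>\<^sub>v v + A *\<^sub>v poly_apply A (f * g) v)"
    by (simp add: mult_pCons_left poly_apply_add[OF v] poly_apply_smult[OF v] poly_apply_pCons[OF v])
  also have "0 \<cdot>\<^sub>v v + A *\<^sub>v poly_apply A (f * g) v = A *\<^sub>v poly_apply A (f * g) v"
    using v A c[of "f * g"] by (intro eq_vecI) auto
  finally show ?case using pCons by (simp add: poly_apply_pCons[OF c])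
qed

lemma pow_mat_Suc_mult_vec:
  assumes v: "v \<in> carrier_vec n"
  shows "A ^\<^sub>m Suc m *\<^sub>v v = A *\<^sub>v (A ^\<^sub>m m *\<^sub>v v)"
proof -
  have "A ^\<^sub>m Suc m = A * A ^\<^sub>m m"
  proof (induction m)
    case 0
    then show ?case using A by simp
  next
    case (Suc m)
    have "A ^\<^sub>m Suc (Suc m) = (A * A ^\<^sub>m m) * A" using Suc by simp
    also have "\<dots> = A * (A ^\<^sub>m m * A)"
      by (rule assoc_mult_mat[OF A pow_carrier_mat[OF A] A])
    finally show ?case by simp
  qed
  then show ?thesis using assoc_mult_mat_vec[OF A pow_carrier_mat[OF A] v] by simp
qed

lemma poly_apply_monom:
  assumes v: "v \<in> carrier_vec n"
  shows "poly_apply A (monom c m) v = c \<cdot>\<^sub>v (A ^\<^sub>m m *\<^sub>v v)"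
proof (induction m)
  case 0
  then show ?case
    using v A mult_zero_vec by (simp add: monom_0 poly_apply_pCons[OF v] poly_apply_zero)
next
  case (Suc m)
  have w: "A ^\<^sub>m m *\<^sub>v v \<in> carrier_vec n"
    by (rule mult_mat_vec_carrier[OF pow_carrier_mat[OF A] v])
  have "poly_apply A (monom c (Suc m)) v = 0 \<cdot>\<^sub>v v + A *\<^sub>v (c \<cdot>\<^sub>v (A ^\<^sub>m m *\<^sub>v v))"
    by (simp add: monom_Suc poly_apply_pCons[OF v] Suc)
  also have "A *\<^sub>v (c \<cdot>\<^sub>v (A ^\<^sub>m m *\<^sub>v v)) = c \<cdot>\<^sub>v (A *\<^sub>v (A ^\<^sub>m m *\<^sub>v v))"
    by (rule mult_mat_vec[OF A w])
  also have "0 \<cdot>\<^sub>v v + \<dots> = \<dots>"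
    using v w A by (intro eq_vecI) auto
  finally show ?case using pow_mat_Suc_mult_vec[OF v] by simp
qed

lemma poly_apply_sum_monom:
  assumes v: "v \<in> carrier_vec n" and r: "r < n"
  shows "poly_apply A (\<Sum>i<m. monom (c i) i) v $ r = (\<Sum>i<m. c i * (A ^\<^sub>m i *\<^sub>v v) $ r)"
proof (induction m)
  case 0
  then show ?case using r by (simp add: poly_apply_zero[OF v])
next
  case (Suc m)
  have "poly_apply A (\<Sum>i<m. monom (c i) i) v \<in> carrier_vec n" by (rule poly_apply_carrier[OF v])
  then show ?case using Suc r A v by (simp add: poly_apply_add[OF v] poly_apply_monom[OF v])
qed

end

text \<open>
  Split off a root \<open>a\<close> of \<open>f\<close>, say \<open>f = (X - a) g\<close>.  Either \<open>g(A) v\<close> is an eigenvector for \<open>a\<close>, or it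
  vanishes and \<open>g\<close> replaces \<open>f\<close>.
\<close>

lemma poly_apply_eq_0_imp_eigenvalue:
  fixes A :: "'k::alg_closed_field mat"
  assumes A: "A \<in> carrier_mat n n"
    and v: "v \<in> carrier_vec n" "v \<noteq> 0\<^sub>v n"
    and f: "f \<noteq> 0" "poly_apply A f v = 0\<^sub>v n"
  shows "\<exists>a. poly f a = 0 \<and> eigenvalue A a"
  using f
proof (induction "degree f" arbitrary: f)
  case 0
  then obtain c where c: "f = [:c:]" using degree_eq_zeroE by metis
  then have "c \<cdot>\<^sub>v v = 0\<^sub>v n"
    using 0(3) v(1) A mult_zero_vec[OF A] by (simp add: poly_apply_pCons[OF A] poly_apply_zero[OF A])
  moreover have "c \<noteq> 0" using c 0(2) by auto
  moreover obtain i where "i < n" "v $ i \<noteq> 0" using v by (metis eq_vecI carrier_vecD index_zero_vec)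
  ultimately show ?case using v(1) by (metis carrier_vecD index_smult_vec(1) index_zero_vec(1) mult_eq_0_iff)
next
  case (Suc d)
  then have "degree f > 0" by simp
  then obtain a where a: "poly f a = 0" using alg_closed_imp_poly_has_root by blast
  then obtain g where g: "f = [:- a, 1:] * g" using poly_eq_0_iff_dvd by blast
  have g0: "g \<noteq> 0" using g Suc(3) by auto
  have "degree f = Suc (degree g)" unfolding g using g0 by (subst degree_mult_eq) auto
  then have dg: "d = degree g" using Suc(2) by simp
  let ?w = "poly_apply A g v"
  have w: "?w \<in> carrier_vec n" by (rule poly_apply_carrier[OF A v(1)])
  show ?case
  proof (cases "?w = 0\<^sub>v n")
    case True
    then obtain b where "poly g b = 0" "eigenvalue A b" using Suc(1)[OF dg g0] by blast
    then show ?thesis using g by auto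
  next
    case False
    have "- a \<cdot>\<^sub>v ?w + A *\<^sub>v ?w = 0\<^sub>v n"
    proof -
      have "poly_apply A [:- a, 1:] ?w = - a \<cdot>\<^sub>v ?w + A *\<^sub>v (1 \<cdot>\<^sub>v ?w + A *\<^sub>v 0\<^sub>v n)"
        by (simp only: poly_apply_pCons[OF A w] poly_apply_zero[OF A w])
      moreover have "1 \<cdot>\<^sub>v ?w + A *\<^sub>v 0\<^sub>v n = ?w" using w by (simp add: mult_zero_vec[OF A])
      ultimately show ?thesis using Suc(4) unfolding g poly_apply_mult[OF A v(1)] by simp
    qed
    then have "A *\<^sub>v ?w = a \<cdot>\<^sub>v ?w"
    proof -
      assume e: "- a \<cdot>\<^sub>v ?w + A *\<^sub>v ?w = 0\<^sub>v n"
      show ?thesis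
      proof (rule eq_vecI)
        fix i assume "i < dim_vec (a \<cdot>\<^sub>v ?w)"
        then have i: "i < n" using w by simp
        have "(- a \<cdot>\<^sub>v ?w + A *\<^sub>v ?w) $ i = 0" unfolding e using i by simp
        then show "(A *\<^sub>v ?w) $ i = (a \<cdot>\<^sub>v ?w) $ i" using i w A by simp
      qed (use w A in auto)
    qed
    then have "eigenvector A ?w a" unfolding eigenvector_def using w False A by auto
    then show ?thesis using a unfolding eigenvalue_def by blast
  qed
qed

text \<open>
  An eigenvector \<open>v\<close> of \<open>A\<^sup>m\<close> for \<open>x\<close> is annihilated by the polynomial \<open>X\<^sup>m - x\<close> in \<open>A\<close>.
\<close>

lemma eigenvalue_of_power:
  fixes A :: "'k::alg_closed_field mat"
  assumes A: "A \<in> carrier_mat n n" and m: "m > 0" and ev: "eigenvalue (A ^\<^sub>m m) x"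
  shows "\<exists>y. eigenvalue A y \<and> y ^ m = x"
proof -
  obtain v where v: "v \<in> carrier_vec n" "v \<noteq> 0\<^sub>v n" "A ^\<^sub>m m *\<^sub>v v = x \<cdot>\<^sub>v v"
    using ev A unfolding eigenvalue_def eigenvector_def by auto
  define f where "f = monom 1 m + monom (- x) 0"
  have "poly_apply A f v = 1 \<cdot>\<^sub>v (A ^\<^sub>m m *\<^sub>v v) + - x \<cdot>\<^sub>v (A ^\<^sub>m 0 *\<^sub>v v)"
    unfolding f_def by (simp only: poly_apply_add[OF A v(1)] poly_apply_monom[OF A v(1)])
  also have "\<dots> = 0\<^sub>v n" unfolding v(3) using v(1) A by (intro eq_vecI) auto
  finally have fv: "poly_apply A f v = 0\<^sub>v n" .
  have "poly.coeff f m = 1" using m by (simp add: f_def)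
  then have "f \<noteq> 0" by auto
  from poly_apply_eq_0_imp_eigenvalue[OF A v(1,2) this fv]
  obtain y where "poly f y = 0" "eigenvalue A y" by blast
  then show ?thesis by (intro exI[of _ y]) (simp add: f_def poly_monom)
qed

text \<open>
  The \<open>n + 1\<close> vectors \<open>v, A v, \<dots>, A\<^sup>n v\<close> are linearly dependent.
\<close>

lemma vector_annihilator_exists:
  fixes A :: "'k::field mat"
  assumes A: "A \<in> carrier_mat n n" and v: "v \<in> carrier_vec n"
  shows "\<exists>f. f \<noteq> 0 \<and> degree f \<le> n \<and> poly_apply A f v = 0\<^sub>v n"
proof -
  \<comment> \<open>The columns are the vectors \<open>A\<^sup>i v\<close>, made square by a last row of zeros, so that \<open>det B = 0\<close>.\<close>
  define B where "B = mat (Suc n) (Suc n) (\<lambda>(r, i). if r < n then (A ^\<^sub>m i *\<^sub>v v) $ r else 0)"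
  have B: "B \<in> carrier_mat (Suc n) (Suc n)" by (simp add: B_def)
  have BT: "B\<^sup>T \<in> carrier_mat (Suc n) (Suc n)" using B by simp
  have "B\<^sup>T *\<^sub>v unit_vec (Suc n) n = 0\<^sub>v (Suc n)"
    using B by (intro eq_vecI) (simp_all add: B_def)
  moreover have "unit_vec (Suc n) n \<noteq> (0\<^sub>v (Suc n) :: 'k vec)"
    by (metis index_unit_vec(2) index_zero_vec(1) lessI zero_neq_one)
  ultimately have "det (B\<^sup>T) = 0"
    using det_0_iff_vec_prod_zero[OF BT] unit_vec_carrier by blast
  then have "det B = 0" using det_transpose[OF B] by simp
  then obtain c where c: "c \<in> carrier_vec (Suc n)" "c \<noteq> 0\<^sub>v (Suc n)" "B *\<^sub>v c = 0\<^sub>v (Suc n)"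
    using det_0_iff_vec_prod_zero[OF B] by blast
  define f where "f = (\<Sum>i<Suc n. monom (c $ i) i)"
  have coeff: "poly.coeff f i = (if i < Suc n then c $ i else 0)" for i
    unfolding f_def by (simp add: coeff_sum del: sum.lessThan_Suc)
  obtain i where "i < Suc n" "c $ i \<noteq> 0" using c(1,2) by (metis eq_vecI carrier_vecD index_zero_vec)
  then have "f \<noteq> 0" using coeff[of i] by auto
  moreover have "degree f \<le> n" by (rule degree_le) (simp add: coeff)
  moreover have "poly_apply A f v = 0\<^sub>v n"
  proof (rule eq_vecI)
    fix r assume "r < dim_vec (0\<^sub>v n :: 'k vec)"
    then have r: "r < n" by simp
    have "poly_apply A f v $ r = (\<Sum>i<Suc n. c $ i * (A ^\<^sub>m i *\<^sub>v v) $ r)"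
      unfolding f_def by (rule poly_apply_sum_monom[OF A v r])
    also have "\<dots> = (B *\<^sub>v c) $ r"
      using r c(1) by (simp add: B_def scalar_prod_def mult.commute atLeast0LessThan del: sum.lessThan_Suc)
    finally show "poly_apply A f v $ r = 0\<^sub>v n $ r" using r c(3) by simp
  qed (use poly_apply_carrier[OF A v] in auto)
  ultimately show ?thesis by blast
qed

text \<open>
  Let \<open>f = X\<^sup>m g\<close> annihilate \<open>v\<close>, with \<open>g(0) \<noteq> 0\<close> and \<open>m \<le> n\<close>.  No root of \<open>g\<close> is an eigenvalue, so
  \<open>g(A) (A\<^sup>m v) = 0\<close> forces \<open>A\<^sup>m v = 0\<close>.
\<close>

lemma only_eigenvalue_0_imp_nilpotent:
  fixes A :: "'k::alg_closed_field mat"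
  assumes A: "A \<in> carrier_mat n n" and ev: "\<And>x. eigenvalue A x \<Longrightarrow> x = 0"
  shows "A ^\<^sub>m n = 0\<^sub>m n n"
proof -
  have kill: "A ^\<^sub>m n *\<^sub>v v = 0\<^sub>v n" if v: "v \<in> carrier_vec n" for v
  proof -
    obtain f where f: "f \<noteq> 0" "degree f \<le> n" "poly_apply A f v = 0\<^sub>v n"
      using vector_annihilator_exists[OF A v] by blast
    define m where "m = order 0 f"
    obtain g where g: "f = [:- 0, 1:] ^ m * g" "\<not> [:- 0, 1:] dvd g"
      using order_decomp[OF f(1), of 0] unfolding m_def by blast
    have g0: "g \<noteq> 0" "poly g 0 \<noteq> 0" using g(2) f(1) g(1) by (auto simp: poly_eq_0_iff_dvd)
    have mono: "[:- 0, 1:] ^ m = monom (1 :: 'k) m" by (simp add: monom_altdef)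
    have m: "m \<le> n" using order_degree[OF f(1), of 0] f(2) unfolding m_def by simp
    let ?w = "A ^\<^sub>m m *\<^sub>v v"
    have w: "?w \<in> carrier_vec n" by (rule mult_mat_vec_carrier[OF pow_carrier_mat[OF A] v])
    have "f = g * monom 1 m" using g(1) mono by (simp add: mult.commute)
    then have "poly_apply A g ?w = 0\<^sub>v n"
      using f(3) w by (simp add: poly_apply_mult[OF A v] poly_apply_monom[OF A v])
    then have w0: "?w = 0\<^sub>v n"
      using poly_apply_eq_0_imp_eigenvalue[OF A w _ g0(1)] ev g0(2) by blast
    have "A ^\<^sub>m (m + k) *\<^sub>v v = 0\<^sub>v n" for k
      by (induction k) (simp_all add: w0 pow_mat_Suc_mult_vec[OF A v] mult_zero_vec[OF A] del: pow_mat.simps)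
    from this[of "n - m"] show ?thesis using m by simp
  qed
  show ?thesis
  proof (rule eq_matI)
    fix i j assume "i < dim_row (0\<^sub>m n n :: 'k mat)" "j < dim_col (0\<^sub>m n n :: 'k mat)"
    then have ij: "i < n" "j < n" by auto
    have "(P *\<^sub>v unit_vec n j) $ i = P $$ (i, j)" if "P \<in> carrier_mat n n" for P :: "'k mat"
      using ij that by simp
    from this[OF pow_carrier_mat[OF A]]
    have "(A ^\<^sub>m n *\<^sub>v unit_vec n j) $ i = (A ^\<^sub>m n) $$ (i, j)" .
    then show "(A ^\<^sub>m n) $$ (i, j) = 0\<^sub>m n n $$ (i, j)" using kill[of "unit_vec n j"] ij by simp
  qed (use A in auto)
qed

section \<open>Eigenvalues of matrices over a local field\<close>

locale valued_field_extension =
  valuation_subring V + nonarchimedean_local_field av + field_hom \<iota>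
  for V :: "'k::field set" and av :: "'a::field \<Rightarrow> real" and \<iota> :: "'a \<Rightarrow> 'k" +
  assumes hom_mem_iff: "\<iota> x \<in> V \<longleftrightarrow> av x \<le> 1"
begin

lemma hom_val_le_iff: "\<iota> x \<preceq>\<^sub>v \<iota> y \<longleftrightarrow> av x \<le> av y"
proof (cases "y = 0")
  case True
  then show ?thesis using av_nonneg[of x] av_eq_0_iff[of x] by (auto simp: antisym)
next
  case False
  have "\<iota> x \<preceq>\<^sub>v \<iota> y \<longleftrightarrow> \<iota> (x / y) \<in> V"
    using False by (simp add: val_le_divide_iff hom_div)
  also have "\<dots> \<longleftrightarrow> av x \<le> av y"
    using False av_pos_iff[of y] by (simp add: hom_mem_iff av_divide divide_le_eq_1)
  finally show ?thesis .
qed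

lemma hom_val_less_iff: "\<iota> x \<prec>\<^sub>v \<iota> y \<longleftrightarrow> av x < av y"
  unfolding val_less_def hom_val_le_iff by auto

lemma hom_val_eq_iff: "\<iota> x \<approx>\<^sub>v \<iota> y \<longleftrightarrow> av x = av y"
  unfolding val_eq_def hom_val_le_iff by auto

text \<open>
  These are the elements of degree at most \<open>n\<close> over the base field.  In the form of eigenvalues
  they are visibly stable under \<open>x \<mapsto> x ^ m - 1\<close> with the same \<open>n\<close>.
\<close>

definition matrix_eigenvalue :: "nat \<Rightarrow> 'k \<Rightarrow> bool" where
  "matrix_eigenvalue n x \<longleftrightarrow> (\<exists>A \<in> carrier_mat n n. eigenvalue (map_mat \<iota> A) x)"

lemma matrix_eigenvalue_root:
  assumes "matrix_eigenvalue n x"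
  shows "\<exists>f. poly.coeff f n = 1 \<and> (\<Sum>i\<le>n. \<iota> (poly.coeff f i) * x ^ i) = 0"
proof -
  obtain A where A: "A \<in> carrier_mat n n" "eigenvalue (map_mat \<iota> A) x"
    using assms unfolding matrix_eigenvalue_def by blast
  have "poly (map_poly \<iota> (char_poly A)) x = 0"
    using A(2) eigenvalue_root_char_poly[of "map_mat \<iota> A" n x] A(1) by (simp add: char_poly_hom[OF A(1)])
  moreover have "degree (map_poly \<iota> (char_poly A)) = n"
    using degree_monic_char_poly[OF A(1)] by simp
  ultimately have "(\<Sum>i\<le>n. \<iota> (poly.coeff (char_poly A) i) * x ^ i) = 0"
    by (simp add: poly_altdef)
  then show ?thesis using degree_monic_char_poly[OF A(1)] by blast
qed

lemma matrix_eigenvalue_power_minus_one: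
  assumes "matrix_eigenvalue n x"
  shows "matrix_eigenvalue n (x ^ m - 1)"
proof -
  obtain A where A: "A \<in> carrier_mat n n" "eigenvalue (map_mat \<iota> A) x"
    using assms unfolding matrix_eigenvalue_def by blast
  have \<iota>A: "map_mat \<iota> A \<in> carrier_mat n n" using A(1) by simp
  have "eigenvalue (map_mat \<iota> A ^\<^sub>m m - 1\<^sub>m n) (x ^ m - 1)"
    using eigenvalue_pow[OF \<iota>A A(2), of m] eigenvalue_minus_one_iff[OF pow_carrier_mat[OF \<iota>A]] by simp
  then have "eigenvalue (map_mat \<iota> (A ^\<^sub>m m - 1\<^sub>m n)) (x ^ m - 1)"
    by (simp only: map_mat_pow_minus_one[OF A(1)])
  moreover have "A ^\<^sub>m m - 1\<^sub>m n \<in> carrier_mat n n" by (rule minus_carrier_mat) simp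
  ultimately show ?thesis unfolding matrix_eigenvalue_def by blast
qed

text \<open>
  Two nonzero terms \<open>f\<^sub>a x\<^sup>a\<close> and \<open>f\<^sub>b x\<^sup>b\<close> of the relation \<open>f(x) = 0\<close> have the same size, so
  \<open>x ^ (b - a)\<close> has the size of \<open>f\<^sub>a / f\<^sub>b\<close>.  The exponent \<open>fact n\<close> is a common multiple of all
  possible differences, hence independent of \<open>x\<close>.
\<close>

lemma eigenvalue_fact_power_val_eq_base:
  assumes x: "matrix_eigenvalue n x" "x \<noteq> 0"
  shows "\<exists>c. c \<noteq> 0 \<and> x ^ fact n \<approx>\<^sub>v \<iota> c"
proof -
  obtain f where f: "poly.coeff f n = 1" "(\<Sum>i\<le>n. \<iota> (poly.coeff f i) * x ^ i) = 0"
    using matrix_eigenvalue_root[OF x(1)] by blast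
  let ?t = "\<lambda>i. \<iota> (poly.coeff f i) * x ^ i"
  have "\<exists>i\<in>{..n}. \<exists>j\<in>{..n}. i \<noteq> j \<and> ?t i \<noteq> 0 \<and> ?t i \<approx>\<^sub>v ?t j"
    by (rule vanishing_sum_two_dominant[of _ _ n]) (use f x(2) in auto)
  then obtain i j where ij: "i \<le> n" "j \<le> n" "i \<noteq> j" "?t i \<noteq> 0" "?t i \<approx>\<^sub>v ?t j" by blast
  have tj: "?t j \<noteq> 0"
  proof
    assume "?t j = 0"
    moreover have "?t i \<preceq>\<^sub>v ?t j" using ij(5) unfolding val_eq_def by blast
    ultimately have "?t i \<preceq>\<^sub>v 0" by (simp only:)
    then show False using ij(4) unfolding val_le_zero_iff by blast
  qed
  have step: "\<exists>c. c \<noteq> 0 \<and> x ^ fact n \<approx>\<^sub>v \<iota> c"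
    if "a < b" "b \<le> n" "?t a \<noteq> 0" "?t b \<noteq> 0" "?t a \<approx>\<^sub>v ?t b" for a b
  proof -
    let ?c = "poly.coeff f a / poly.coeff f b"
    have nz: "poly.coeff f a \<noteq> 0" "poly.coeff f b \<noteq> 0" using that(3,4) by auto
    let ?d = "\<iota> (poly.coeff f b) * x ^ a"
    have d: "?d \<noteq> 0" using nz x(2) by simp
    have tb: "?t b = ?d * x ^ (b - a)" using that(1) by (simp add: mult.assoc flip: power_add)
    have ta: "?t a = ?d * \<iota> ?c" using nz by (simp add: hom_div)
    have "x ^ (b - a) \<approx>\<^sub>v \<iota> ?c"
      using that(5) unfolding ta tb val_eq_def val_le_mult_cancel[OF d] by simp
    moreover have "b - a dvd fact n" by (rule dvd_fact) (use that in auto)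
    then obtain r where r: "(fact n :: nat) = (b - a) * r" by blast
    ultimately have "x ^ fact n \<approx>\<^sub>v \<iota> (?c ^ r)"
      using val_eq_power[of "x ^ (b - a)" "\<iota> ?c" r] by (simp add: power_mult hom_power)
    then show ?thesis using nz by (intro exI[of _ "?c ^ r"]) simp
  qed
  show ?thesis
  proof (cases "i < j")
    case True
    then show ?thesis using step[of i j] ij tj by blast
  next
    case False
    then show ?thesis using step[of j i] ij tj val_eq_sym by auto
  qed
qed

text \<open>
  With \<open>x ^ fact n\<close> of size \<open>\<pi> ^ s\<close> and \<open>y ^ fact n\<close> of size \<open>\<pi> ^ r\<close>, the relation \<open>y ^ (p ^ k) = x\<close>
  gives \<open>s = r p ^ k\<close>.  So every power of \<open>p\<close> divides \<open>s\<close>, and \<open>s = 0\<close>.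
\<close>

lemma eigenvalue_power_roots_unit:
  assumes p: "2 \<le> p"
    and x: "matrix_eigenvalue n x" "x \<noteq> 0"
    and roots: "\<And>k. \<exists>y. matrix_eigenvalue n y \<and> y ^ (p ^ k) = x"
  shows "x \<approx>\<^sub>v 1"
proof -
  obtain \<pi> where \<pi>: "\<pi> \<noteq> 0" "av \<pi> < 1" "\<And>z. z \<noteq> 0 \<Longrightarrow> \<exists>s::int. av z = av \<pi> powi s"
    using discrete by blast
  have \<pi>_pos: "0 < av \<pi>" using \<pi>(1) by (simp add: av_pos_iff)
  obtain c where c: "c \<noteq> 0" "x ^ fact n \<approx>\<^sub>v \<iota> c" using eigenvalue_fact_power_val_eq_base[OF x] by blast
  obtain s where s: "av c = av \<pi> powi s" using \<pi>(3)[OF c(1)] by blast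
  have dvd: "int p ^ k dvd s" for k
  proof -
    obtain y where y: "matrix_eigenvalue n y" "y ^ (p ^ k) = x" using roots by blast
    have "y \<noteq> 0" using y(2) x(2) p by (auto simp: power_0_left split: if_splits)
    then obtain d where d: "d \<noteq> 0" "y ^ fact n \<approx>\<^sub>v \<iota> d"
      using eigenvalue_fact_power_val_eq_base[OF y(1)] by blast
    obtain r where r: "av d = av \<pi> powi r" using \<pi>(3)[OF d(1)] by blast
    have "x ^ fact n = (y ^ fact n) ^ (p ^ k)"
      unfolding y(2)[symmetric] by (simp add: power_mult[symmetric] mult.commute)
    then have "x ^ fact n \<approx>\<^sub>v \<iota> (d ^ (p ^ k))"
      using val_eq_power[OF d(2), of "p ^ k"] by (simp add: hom_power)
    then have "\<iota> c \<approx>\<^sub>v \<iota> (d ^ (p ^ k))" using val_eq_trans[OF val_eq_sym[OF c(2)]] by blast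
    then have "av \<pi> powi s = av \<pi> powi (r * int (p ^ k))"
      unfolding hom_val_eq_iff av_power s r by (simp add: power_int_mult flip: of_nat_power)
    then have "s = r * int (p ^ k)"
      using \<pi>_pos \<pi>(2) power_int_strict_decreasing[of _ _ "av \<pi>"]
      by (metis linorder_neq_iff order_less_irrefl)
    then show ?thesis by simp
  qed
  have "s = 0"
  proof (rule ccontr)
    assume "s \<noteq> 0"
    define k where "k = nat \<bar>s\<bar>"
    have "int p ^ k \<le> \<bar>s\<bar>" using dvd[of k] \<open>s \<noteq> 0\<close> by (metis abs_of_nonneg dvd_imp_le_int of_nat_0_le_iff zero_le_power)
    moreover have "k < 2 ^ k" by simp
    then have "\<bar>s\<bar> < 2 ^ k" unfolding k_def by (metis abs_ge_zero int_nat_eq of_nat_less_numeral_power_cancel_iff)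
    moreover have "(2::int) ^ k \<le> int p ^ k" using p by (intro power_mono) auto
    ultimately show False by linarith
  qed
  then have "\<iota> c \<approx>\<^sub>v \<iota> 1" unfolding hom_val_eq_iff s by simp
  then have "x ^ fact n \<approx>\<^sub>v 1 ^ fact n" using val_eq_trans[OF c(2)] by simp
  then show ?thesis by (subst (asm) val_eq_power_iff) simp_all
qed

definition power_combination :: "'k \<Rightarrow> nat \<Rightarrow> (nat \<Rightarrow> 'a) \<Rightarrow> 'k" where
  "power_combination x d c = (\<Sum>i<d. \<iota> (c i) * x ^ i)"

lemma val_less_scaled_power_sum:
  assumes "x \<preceq>\<^sub>v 1" "\<And>i. i \<in> I \<Longrightarrow> av (c i) < 1"
  shows "(\<Sum>i\<in>I. \<iota> (c i) * x ^ i) \<prec>\<^sub>v 1"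
proof (rule val_less_sum)
  fix i assume "i \<in> I"
  then have "\<iota> (c i) \<prec>\<^sub>v \<iota> 1" unfolding hom_val_less_iff using assms(2) by simp
  moreover have "\<iota> (c i) * x ^ i \<preceq>\<^sub>v \<iota> (c i) * 1"
    using val_le_mult[OF val_le_refl val_le_power[OF assms(1), of i]] by simp
  ultimately show "\<iota> (c i) * x ^ i \<prec>\<^sub>v 1" using val_le_less_trans by simp
qed simp

text \<open>
  The residue of \<open>x\<close> is algebraic of degree at most \<open>n\<close>.  Dividing \<open>f(x) = 0\<close> by a coefficient of
  greatest absolute value makes all coefficients integral, and the choice of the highest such
  coefficient makes the relation monic modulo the maximal ideal.  The conclusion
  excludes \<open>d = 0\<close>, for which it would read \<open>1 \<prec>\<^sub>v 1\<close>.
\<close>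

lemma eigenvalue_monic_relation_mod:
  assumes x: "matrix_eigenvalue n x" "x \<preceq>\<^sub>v 1"
  shows "\<exists>d\<le>n. \<exists>b. (\<forall>i<d. av (b i) \<le> 1) \<and> x ^ d + power_combination x d b \<prec>\<^sub>v 1"
proof -
  obtain f where f: "poly.coeff f n = 1" "(\<Sum>i\<le>n. \<iota> (poly.coeff f i) * x ^ i) = 0"
    using matrix_eigenvalue_root[OF x(1)] by blast
  define a where "a i = av (poly.coeff f i)" for i
  define top where "top = Max (a ` {..n})"
  have a_le: "a i \<le> top" if "i \<le> n" for i unfolding top_def using that by (intro Max_ge) auto
  have "top \<in> a ` {..n}" unfolding top_def by (intro Max_in) auto
  define d where "d = Max {i. i \<le> n \<and> a i = top}"
  have "d \<in> {i. i \<le> n \<and> a i = top}"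
    unfolding d_def by (intro Max_in) (use \<open>top \<in> a ` {..n}\<close> in auto)
  then have d: "d \<le> n" "a d = top" by auto
  have above: "a i < top" if "d < i" "i \<le> n" for i
  proof (rule ccontr)
    assume "\<not> a i < top"
    then have "i \<in> {i. i \<le> n \<and> a i = top}" using a_le[OF that(2)] that(2) by simp
    then have "i \<le> d" unfolding d_def by (intro Max_ge) auto
    then show False using that(1) by simp
  qed
  have top_pos: "0 < top" using a_le[of n] f(1) by (simp add: a_def)
  define b where "b i = poly.coeff f i / poly.coeff f d" for i
  have fd: "poly.coeff f d \<noteq> 0" using d(2) top_pos by (auto simp: a_def)
  have b_le: "av (b i) \<le> 1" if "i \<le> n" for i
    using a_le[OF that] d(2) top_pos by (simp add: b_def av_divide a_def divide_le_eq_1)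
  have b_less: "av (b i) < 1" if "d < i" "i \<le> n" for i
    using above[OF that] d(2) top_pos by (simp add: b_def av_divide a_def divide_less_eq_1)
  have "x ^ d + (\<Sum>i<d. \<iota> (b i) * x ^ i) \<prec>\<^sub>v 1"
  proof -
    have "(\<Sum>i\<le>n. \<iota> (b i) * x ^ i) = 0"
    proof -
      have "\<iota> (poly.coeff f d) * (\<Sum>i\<le>n. \<iota> (b i) * x ^ i) = (\<Sum>i\<le>n. \<iota> (poly.coeff f i) * x ^ i)"
        unfolding sum_distrib_left b_def using fd by (intro sum.cong) (simp_all add: hom_div)
      then show ?thesis using f(2) fd by simp
    qed
    moreover have "{..n} = insert d ({..<d} \<union> {d<..n})" using d(1) by auto
    moreover have "b d = 1" using fd by (simp add: b_def)
    ultimately have "x ^ d + (\<Sum>i<d. \<iota> (b i) * x ^ i) = - (\<Sum>i\<in>{d<..n}. \<iota> (b i) * x ^ i)"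
      by (simp add: sum.union_disjoint eq_neg_iff_add_eq_0 add.assoc disjoint_iff)
    moreover have "(\<Sum>i\<in>{d<..n}. \<iota> (b i) * x ^ i) \<prec>\<^sub>v 1"
      using b_less by (intro val_less_scaled_power_sum x(2)) simp
    ultimately show ?thesis by simp
  qed
  then have "x ^ d + power_combination x d b \<prec>\<^sub>v 1" by (simp add: power_combination_def)
  then show ?thesis using d(1) b_le by (intro exI[of _ d] exI[of _ b] conjI) auto
qed

text \<open>
  Reduction of powers modulo a monic relation: multiplication by \<open>x\<close> shifts the coefficients, and
  the overflow \<open>c\<^sub>e x\<^sup>d\<close> is replaced by means of the relation.
\<close>

lemma powers_in_power_combination_mod:
  assumes x1: "x \<preceq>\<^sub>v 1"
    and b: "\<And>i. i < d \<Longrightarrow> av (b i) \<le> 1"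
    and rel: "x ^ d + power_combination x d b \<prec>\<^sub>v 1"
  shows "\<exists>c. (\<forall>i<d. av (c i) \<le> 1) \<and> x ^ j - power_combination x d c \<prec>\<^sub>v 1"
proof (induction j)
  case 0
  show ?case
  proof (cases "d = 0")
    case True
    then show ?thesis using rel by (simp add: power_combination_def)
  next
    case False
    have "power_combination x d (\<lambda>i. if i = 0 then 1 else 0) = 1"
    proof -
      have "power_combination x d (\<lambda>i. if i = 0 then 1 else 0) = (\<Sum>i<d. if i = 0 then 1 else 0)"
        unfolding power_combination_def by (intro sum.cong) auto
      then show ?thesis using False by simp
    qed
    then show ?thesis by (intro exI[of _ "\<lambda>i. if i = 0 then 1 else 0"]) simp
  qed
next
  case (Suc j)
  then obtain c where c: "\<And>i. i < d \<Longrightarrow> av (c i) \<le> 1" "x ^ j - power_combination x d c \<prec>\<^sub>v 1" by blast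
  show ?case
  proof (cases d)
    case 0
    have "x * x ^ j \<prec>\<^sub>v 1"
      using val_le_less_trans[OF val_le_mult[OF x1 val_le_refl[of "x ^ j"]]] c(2) 0
      by (simp add: power_combination_def)
    then show ?thesis using 0 by (simp add: power_combination_def)
  next
    case (Suc e)
    define c' where "c' i = (if i = 0 then 0 else c (i - 1)) - c e * b i" for i
    have xspan: "x * power_combination x d c = \<iota> (c e) * x ^ d + (\<Sum>i<d. \<iota> (if i = 0 then 0 else c (i - 1)) * x ^ i)"
    proof -
      have "x * power_combination x d c = (\<Sum>i<Suc e. \<iota> (c i) * x ^ Suc i)"
        unfolding power_combination_def Suc sum_distrib_left by (simp add: algebra_simps)
      also have "\<dots> = \<iota> (c e) * x ^ d + (\<Sum>i<e. \<iota> (c i) * x ^ Suc i)" by (simp add: Suc)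
      also have "(\<Sum>i<e. \<iota> (c i) * x ^ Suc i)
        = (\<Sum>i<d. \<iota> (if i = 0 then 0 else c (i - 1)) * x ^ i)"
        unfolding Suc sum.lessThan_Suc_shift by simp
      finally show ?thesis .
    qed
    have "power_combination x d c' = (\<Sum>i<d. \<iota> (if i = 0 then 0 else c (i - 1)) * x ^ i) - \<iota> (c e) * (\<Sum>i<d. \<iota> (b i) * x ^ i)"
      unfolding power_combination_def c'_def sum_distrib_left sum_subtractf[symmetric]
      by (intro sum.cong refl) (simp only: hom_minus hom_mult, simp add: algebra_simps)
    then have eq: "x ^ Suc j - power_combination x d c'
      = x * (x ^ j - power_combination x d c) + \<iota> (c e) * (x ^ d + (\<Sum>i<d. \<iota> (b i) * x ^ i))"
      using xspan by (simp add: algebra_simps)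
    have "x * (x ^ j - power_combination x d c) \<prec>\<^sub>v 1"
      using val_le_less_trans[OF val_le_mult[OF x1 val_le_refl]] c(2) by simp
    moreover have "\<iota> (c e) \<preceq>\<^sub>v 1"
      using c(1)[of e] Suc hom_val_le_iff[of "c e" 1] by simp
    then have "\<iota> (c e) * (x ^ d + (\<Sum>i<d. \<iota> (b i) * x ^ i)) \<prec>\<^sub>v 1"
      using val_le_less_trans[OF val_le_mult[OF _ val_le_refl]] rel by (simp add: power_combination_def)
    ultimately have "x ^ Suc j - power_combination x d c' \<prec>\<^sub>v 1" unfolding eq by (rule val_less_add)
    moreover have "av (c' i) \<le> 1" if "i < d" for i
    proof -
      have "av (if i = 0 then 0 else c (i - 1)) \<le> 1" using c(1)[of "i - 1"] that by auto
      moreover have "av (c e * b i) \<le> 1"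
        using c(1)[of e] b[of i] that Suc av_nonneg by (simp add: av_mult mult_le_one)
      ultimately show ?thesis
        unfolding c'_def using closed_subringD(6)[OF integers_closed_subring] by blast
    qed
    ultimately show ?thesis by blast
  qed
qed

lemma power_combination_representatives:
  assumes x1: "x \<preceq>\<^sub>v 1"
    and R: "\<And>c. av c \<le> 1 \<Longrightarrow> \<exists>r\<in>R. av (c - r) < 1"
    and c: "\<And>i. i < d \<Longrightarrow> av (c i) \<le> 1"
  shows "\<exists>r \<in> {..<d} \<rightarrow>\<^sub>E R. power_combination x d c - power_combination x d r \<prec>\<^sub>v 1"
proof -
  have "\<forall>i\<in>{..<d}. \<exists>r. r \<in> R \<and> av (c i - r) < 1" using R c by blast
  then obtain r where r: "\<And>i. i < d \<Longrightarrow> r i \<in> R \<and> av (c i - r i) < 1"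
    by (metis bchoice lessThan_iff)
  have "power_combination x d c - power_combination x d (restrict r {..<d}) = (\<Sum>i<d. \<iota> (c i - r i) * x ^ i)"
    unfolding power_combination_def by (simp add: sum_subtractf[symmetric] hom_minus algebra_simps)
  moreover have "(\<Sum>i<d. \<iota> (c i - r i) * x ^ i) \<prec>\<^sub>v 1"
    using r by (intro val_less_scaled_power_sum x1) simp
  moreover have "restrict r {..<d} \<in> {..<d} \<rightarrow>\<^sub>E R" using r by auto
  ultimately show ?thesis by (metis (no_types, lifting))
qed

text \<open>
  A version of Lagrange's theorem for the residues.  Every power of \<open>x\<close> is congruent to one of at
  most \<open>Q = card R ^ n\<close> combinations of \<open>1, x, \<dots>, x ^ (d - 1)\<close>, so two of the powers \<open>x\<^sup>0, \<dots>, x ^ Q\<close>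
  are congruent and \<open>x\<close> has order at most \<open>Q\<close> modulo the maximal ideal.  The exponent \<open>fact Q\<close> is a
  multiple of all such orders and therefore serves all \<open>x\<close> simultaneously.
\<close>

lemma eigenvalue_unit_power_residue_one:
  "\<exists>M\<ge>1. \<forall>x. matrix_eigenvalue n x \<and> x \<approx>\<^sub>v 1 \<longrightarrow> x ^ M - 1 \<prec>\<^sub>v 1"
proof -
  obtain R where R: "finite R" "R \<noteq> {}" "\<And>c. av c \<le> 1 \<Longrightarrow> \<exists>r\<in>R. av (c - r) < 1"
    using finite_residue_representatives by metis
  define Q where "Q = card R ^ n"
  have "x ^ fact Q - 1 \<prec>\<^sub>v 1" if x: "matrix_eigenvalue n x" "x \<approx>\<^sub>v 1" for x
  proof -
    have x1: "x \<preceq>\<^sub>v 1" using x(2) unfolding val_eq_def by simp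
    have xpow1: "x ^ j \<preceq>\<^sub>v 1" for j using val_le_power[OF x1, of j] by simp
    obtain d b where d: "d \<le> n" and b: "\<And>i. i < d \<Longrightarrow> av (b i) \<le> 1"
      and rel: "x ^ d + power_combination x d b \<prec>\<^sub>v 1"
      using eigenvalue_monic_relation_mod[OF x(1) x1] by blast
    have "\<exists>r \<in> {..<d} \<rightarrow>\<^sub>E R. x ^ j - power_combination x d r \<prec>\<^sub>v 1" for j
    proof -
      obtain c where c: "\<And>i. i < d \<Longrightarrow> av (c i) \<le> 1" "x ^ j - power_combination x d c \<prec>\<^sub>v 1"
        using powers_in_power_combination_mod[of x d b j, OF x1 b rel] by blast
      obtain r where r: "r \<in> {..<d} \<rightarrow>\<^sub>E R" "power_combination x d c - power_combination x d r \<prec>\<^sub>v 1"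
        using power_combination_representatives[of x R d c, OF x1 R(3) c(1)] by blast
      show ?thesis using r(1) val_less_add[OF c(2) r(2)] by (intro bexI[of _ r]) simp_all
    qed
    then obtain \<rho> where \<rho>: "\<And>j. \<rho> j \<in> {..<d} \<rightarrow>\<^sub>E R" "\<And>j. x ^ j - power_combination x d (\<rho> j) \<prec>\<^sub>v 1"
      by metis
    have "\<not> inj_on \<rho> {..Q}"
    proof
      assume inj: "inj_on \<rho> {..Q}"
      have fin: "finite ({..<d} \<rightarrow>\<^sub>E R)" using R(1) by (intro finite_PiE) auto
      have "card {..Q} \<le> card ({..<d} \<rightarrow>\<^sub>E R)"
        by (rule card_inj_on_le[OF inj _ fin]) (use \<rho>(1) in blast)
      also have "\<dots> = card R ^ d" by (simp add: card_PiE)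
      also have "\<dots> \<le> Q"
        unfolding Q_def using R(1,2) d by (intro power_increasing) (simp_all add: Suc_le_eq card_gt_0_iff)
      finally show False by simp
    qed
    then obtain i j where ij: "i \<le> Q" "j \<le> Q" "i < j" "\<rho> i = \<rho> j"
      unfolding inj_on_def by (metis atMost_iff linorder_neqE_nat)
    have "x ^ j - x ^ i \<prec>\<^sub>v 1"
      using val_less_diff[OF \<rho>(2)[of j] \<rho>(2)[of i]] ij(4) by simp
    moreover have "x ^ j - x ^ i = x ^ i * (x ^ (j - i) - 1)"
      using ij(3) by (simp add: algebra_simps flip: power_add)
    moreover have "1 \<preceq>\<^sub>v x ^ i"
      using val_eq_power[OF x(2), of i] unfolding val_eq_def by simp
    then have "1 * (x ^ (j - i) - 1) \<preceq>\<^sub>v x ^ i * (x ^ (j - i) - 1)"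
      by (rule val_le_mult[OF _ val_le_refl])
    ultimately have e: "x ^ (j - i) - 1 \<prec>\<^sub>v 1" using val_le_less_trans by simp
    have "j - i dvd fact Q" by (rule dvd_fact) (use ij in auto)
    then obtain r where r: "(fact Q :: nat) = (j - i) * r" by blast
    have "(x ^ (j - i)) ^ r - 1 = (x ^ (j - i) - 1) * (\<Sum>l<r. (x ^ (j - i)) ^ l)"
      by (rule power_diff_1_eq)
    moreover have "(\<Sum>l<r. (x ^ (j - i)) ^ l) \<preceq>\<^sub>v 1"
      by (intro val_le_sum) (simp add: xpow1 flip: power_mult)
    then have "(x ^ (j - i) - 1) * (\<Sum>l<r. (x ^ (j - i)) ^ l) \<preceq>\<^sub>v (x ^ (j - i) - 1) * 1"
      by (intro val_le_mult val_le_refl)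
    ultimately have "(x ^ (j - i)) ^ r - 1 \<prec>\<^sub>v 1" using e val_le_less_trans by simp
    then show ?thesis by (simp add: r power_mult)
  qed
  then show ?thesis by (intro exI[of _ "fact Q"]) simp
qed

text \<open>
  A \<open>p ^ k\<close>-th root \<open>y\<close> of \<open>x\<close> satisfies \<open>y ^ M = 1 + e\<close> with \<open>e\<close> in the maximal ideal, and then
  \<open>x ^ M = (1 + e) ^ (p ^ k)\<close>.  The distance of this power from 1 is bounded by a quantity
  that tends to 0 as \<open>k\<close> grows, unless \<open>e\<close> approaches the size of a unit.  It cannot, because \<open>e ^ fact n\<close> has the size of an element of the
  discretely valued base field.
\<close>

theorem eigenvalue_power_roots_imp_root_of_unity:
  assumes p: "2 \<le> p" "av (of_nat p) < 1"
  shows "\<exists>M\<ge>1. \<forall>x. matrix_eigenvalue n x \<and> x \<noteq> 0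
    \<and> (\<forall>k. \<exists>y. matrix_eigenvalue n y \<and> y ^ (p ^ k) = x) \<longrightarrow> x ^ M = 1"
proof -
  obtain M where M: "1 \<le> M" "\<And>y. matrix_eigenvalue n y \<Longrightarrow> y \<approx>\<^sub>v 1 \<Longrightarrow> y ^ M - 1 \<prec>\<^sub>v 1"
    using eigenvalue_unit_power_residue_one by blast
  obtain \<pi> where \<pi>: "\<pi> \<noteq> 0" "av \<pi> < 1" and less_one: "\<And>z. av z < 1 \<Longrightarrow> av z \<le> av \<pi>"
    using uniformizer_exists by blast
  have \<pi>_pos: "0 < av \<pi>" using \<pi>(1) by (simp add: av_pos_iff)
  have "x ^ M = 1"
    if x: "matrix_eigenvalue n x" "x \<noteq> 0" and roots: "\<And>k. \<exists>y. matrix_eigenvalue n y \<and> y ^ (p ^ k) = x"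
    for x
  proof (rule ccontr)
    assume neq: "x ^ M \<noteq> 1"
    define z where "z = x ^ M - 1"
    have x1: "x \<approx>\<^sub>v 1" by (rule eigenvalue_power_roots_unit[OF p(1) x roots])
    have small: "z ^ fact n \<preceq>\<^sub>v \<iota> (\<pi> ^ Suc k)" for k
    proof -
      obtain y where y: "matrix_eigenvalue n y" "y ^ (p ^ k) = x" using roots by blast
      have "y ^ (p ^ k) \<approx>\<^sub>v 1 ^ (p ^ k)" using x1 y(2) by simp
      then have y1: "y \<approx>\<^sub>v 1" using p(1) by (subst (asm) val_eq_power_iff) auto
      define e where "e = y ^ M - 1"
      have e: "matrix_eigenvalue n e" "e \<prec>\<^sub>v 1"
        unfolding e_def using matrix_eigenvalue_power_minus_one[OF y(1)] M(2)[OF y(1) y1] by blast+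
      have e_pow: "e ^ fact n \<preceq>\<^sub>v \<iota> \<pi>"
      proof (cases "e = 0")
        case True
        then show ?thesis by (simp add: power_0_left)
      next
        case False
        then obtain c where c: "e ^ fact n \<approx>\<^sub>v \<iota> c" using eigenvalue_fact_power_val_eq_base[OF e(1)] by blast
        have "e ^ fact n \<prec>\<^sub>v 1 ^ fact n" by (rule val_less_power[OF e(2)]) simp
        moreover have "\<iota> c \<preceq>\<^sub>v e ^ fact n" using c unfolding val_eq_def by simp
        ultimately have "\<iota> c \<prec>\<^sub>v \<iota> 1" using val_le_less_trans by simp
        then have "\<iota> c \<preceq>\<^sub>v \<iota> \<pi>" unfolding hom_val_less_iff hom_val_le_iff using less_one by simp
        then show ?thesis using c val_le_trans unfolding val_eq_def by metis
      qed
      have pi1: "\<iota> \<pi> \<preceq>\<^sub>v 1" using hom_val_le_iff[of \<pi> 1] \<pi>(2) by simp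
      have p_pi: "of_nat p \<preceq>\<^sub>v \<iota> \<pi>"
      proof -
        have "\<iota> (of_nat p) = of_nat p" by (induction p) (simp_all add: hom_add)
        then show ?thesis using hom_val_le_iff[of "of_nat p" \<pi>] less_one[OF p(2)] by simp
      qed
      \<comment> \<open>The larger of \<open>e\<close> and \<open>\<pi>\<close>; its power \<open>t ^ fact n\<close> is a multiple of \<open>\<pi>\<close> in either case.\<close>
      obtain t where t: "e \<preceq>\<^sub>v t" "\<iota> \<pi> \<preceq>\<^sub>v t" "t = e \<or> t = \<iota> \<pi>"
        using val_le_total[of e "\<iota> \<pi>"] val_le_refl by metis
      have t1: "t \<preceq>\<^sub>v 1" using t(3) pi1 val_less_imp_le[OF e(2)] by blast
      have t_pow: "t ^ fact n \<preceq>\<^sub>v \<iota> \<pi>"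
      proof -
        have "\<iota> \<pi> ^ fact n \<preceq>\<^sub>v \<iota> \<pi>"
        proof -
          have "\<iota> \<pi> ^ fact n = \<iota> \<pi> * \<iota> \<pi> ^ (fact n - 1)"
            by (metis fact_gt_zero power_eq_if less_irrefl_nat)
          also have "\<dots> \<preceq>\<^sub>v \<iota> \<pi> * 1 ^ (fact n - 1)" by (intro val_le_mult val_le_power pi1 val_le_refl)
          finally show ?thesis by simp
        qed
        then show ?thesis using t(3) e_pow by blast
      qed
      have "z = (1 + e) ^ (p ^ k) - 1"
        unfolding z_def e_def y(2)[symmetric] by (simp add: mult.commute flip: power_mult)
      then have "z \<preceq>\<^sub>v t ^ Suc k"
        using one_plus_iterated_power[OF t(1) val_le_trans[OF p_pi t(2)] t1] by simp
      then have "z ^ fact n \<preceq>\<^sub>v (t ^ Suc k) ^ fact n" by (rule val_le_power)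
      also have "(t ^ Suc k) ^ fact n = (t ^ fact n) ^ Suc k"
        by (simp only: power_mult[symmetric] mult.commute)
      also have "\<dots> \<preceq>\<^sub>v \<iota> \<pi> ^ Suc k" by (rule val_le_power[OF t_pow])
      finally show ?thesis by (simp add: hom_power hom_mult)
    qed
    have "matrix_eigenvalue n z" "z \<noteq> 0"
      unfolding z_def using matrix_eigenvalue_power_minus_one[OF x(1)] neq by auto
    then obtain c where c: "c \<noteq> 0" "z ^ fact n \<approx>\<^sub>v \<iota> c" using eigenvalue_fact_power_val_eq_base by blast
    obtain k where k: "av \<pi> ^ k < av c"
      using real_arch_pow_inv[of "av c" "av \<pi>"] c(1) \<pi>(2) by (auto simp: av_pos_iff)
    have "\<iota> c \<preceq>\<^sub>v \<iota> (\<pi> ^ Suc k)" using val_le_trans[OF _ small[of k]] c(2) unfolding val_eq_def by blast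
    then have "av c \<le> av \<pi> ^ Suc k" unfolding hom_val_le_iff av_power .
    also have "\<dots> \<le> av \<pi> ^ k" using \<pi>_pos \<pi>(2) by (intro power_decreasing) auto
    finally show False using k by simp
  qed
  then show ?thesis using M(1) by (intro exI[of _ M]) blast
qed

end

section \<open>Towers of roots and unipotent powers\<close>

lemma to_ac_field_hom: "field_hom to_ac"
  by unfold_locales auto

text \<open>
  Chevalley's theorem is applied to the integers of the base field and a uniformizer \<open>\<pi>\<close>.  The
  resulting ring contains no further elements of the base field: an element of absolute value
  greater than 1 would have \<open>1/\<pi>\<close> as an integral multiple.
\<close>

theorem valued_field_extension_alg_closure_exists:
  fixes av :: "'a::field \<Rightarrow> real"
  assumes av: "nonarchimedean_local_field av"
  shows "\<exists>V. valued_field_extension V av (to_ac :: 'a \<Rightarrow> 'a alg_closure)"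
proof -
  interpret nonarchimedean_local_field av by (rule av)
  interpret h: field_hom "to_ac :: 'a \<Rightarrow> 'a alg_closure" by (rule to_ac_field_hom)
  obtain \<pi> where \<pi>: "\<pi> \<noteq> 0" "av \<pi> < 1" "\<And>x. av x < 1 \<Longrightarrow> av x \<le> av \<pi>"
    using uniformizer_exists by blast
  have \<pi>_pos: "0 < av \<pi>" using \<pi>(1) by (simp add: av_pos_iff)
  let ?S = "to_ac ` {x. av x \<le> 1}"
  have S: "closed_subring ?S"
    unfolding closed_subring_def
  proof (intro conjI ballI)
    note c = closed_subringD[OF integers_closed_subring]
    show "1 \<in> ?S" using c(1) by (intro image_eqI[of _ _ 1]) simp_all
    fix x assume "x \<in> ?S"
    then obtain a where a: "x = to_ac a" "av a \<le> 1" by auto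
    show "- x \<in> ?S" using a by (intro image_eqI[of _ _ "- a"]) simp_all
    fix y assume "y \<in> ?S"
    then obtain b where b: "y = to_ac b" "av b \<le> 1" by auto
    show "x + y \<in> ?S" using a b c(3)[of a b] by (intro image_eqI[of _ _ "a + b"]) simp_all
    show "x * y \<in> ?S" using a b c(4)[of a b] by (intro image_eqI[of _ _ "a * b"]) simp_all
  qed
  have "\<exists>V. valuation_subring V \<and> ?S \<subseteq> V \<and> inverse (to_ac \<pi>) \<notin> V"
  proof (rule valuation_subring_extending[OF S])
    show "to_ac \<pi> \<in> ?S" using \<pi>(2) by auto
    have "av (inverse \<pi>) > 1" using \<pi>(2) \<pi>_pos by (simp add: av_inverse one_less_inverse)
    then show "inverse (to_ac \<pi>) \<notin> ?S" by (auto simp flip: to_ac_inverse)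
  qed
  then obtain V where V: "valuation_subring V" "?S \<subseteq> V" "inverse (to_ac \<pi>) \<notin> V" by blast
  interpret V: valuation_subring V by (rule V(1))
  have mem: "to_ac x \<in> V \<longleftrightarrow> av x \<le> 1" for x
  proof
    assume x: "to_ac x \<in> V"
    show "av x \<le> 1"
    proof (rule ccontr)
      assume "\<not> av x \<le> 1"
      then have x0: "x \<noteq> 0" and x1: "1 < av x" by auto
      have "av (inverse x) \<le> av \<pi>" using x1 by (intro \<pi>(3)) (simp add: av_inverse inverse_less_1_iff)
      then have "av (inverse x / \<pi>) \<le> 1" using \<pi>_pos by (simp add: av_divide divide_le_eq_1)
      then have "to_ac (inverse x / \<pi>) \<in> V" using V(2) by auto
      then have "to_ac (inverse x / \<pi>) * to_ac x \<in> V" using x V.V_closed(4) by blast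
      moreover have "to_ac (inverse x / \<pi>) * to_ac x = inverse (to_ac \<pi>)"
        using x0 by (simp add: field_simps)
      ultimately show False using V(3) by simp
    qed
  qed (use V(2) in auto)
  have "valued_field_extension V av (to_ac :: 'a \<Rightarrow> 'a alg_closure)"
    by unfold_locales (rule mem)
  then show ?thesis by blast
qed

text \<open>
  The case of the general linear group.  Eigenvalues of \<open>g\<close> in the algebraic closure are
  \<open>p ^ k\<close>-th powers of eigenvalues of the roots of \<open>g\<close>, hence \<open>M\<close>-th roots of unity for a common
  \<open>M\<close>.  Nilpotency of \<open>g ^ M - 1\<close> can be tested over the algebraic closure.
\<close>

theorem power_root_tower_imp_unipotent:
  fixes av :: "'a::field \<Rightarrow> real" and g :: "'a mat"
  assumes av: "nonarchimedean_local_field av" and p: "p = residual_characteristic av"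
    and g: "g \<in> carrier_mat n n" "det g \<noteq> 0"
    and roots: "\<And>k::nat. \<exists>h \<in> carrier_mat n n. h ^\<^sub>m (p ^ k) = g"
  shows "\<exists>r\<ge>1. unipotent (g ^\<^sub>m r)"
proof -
  interpret nonarchimedean_local_field av by (rule av)
  interpret h: field_hom "to_ac :: 'a \<Rightarrow> 'a alg_closure" by (rule to_ac_field_hom)
  obtain V where "valued_field_extension V av (to_ac :: 'a \<Rightarrow> 'a alg_closure)"
    using valued_field_extension_alg_closure_exists[OF av] by blast
  then interpret E: valued_field_extension V av "to_ac :: 'a \<Rightarrow> 'a alg_closure" .
  note p2 = residual_characteristic_bounds[OF p]
  obtain M where M: "1 \<le> M" "\<And>x. E.matrix_eigenvalue n x \<Longrightarrow> x \<noteq> 0 \<Longrightarrow>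
      (\<And>k. \<exists>y. E.matrix_eigenvalue n y \<and> y ^ (p ^ k) = x) \<Longrightarrow> x ^ M = 1"
    using E.eigenvalue_power_roots_imp_root_of_unity[OF p2] by blast
  let ?G = "map_mat (to_ac :: 'a \<Rightarrow> 'a alg_closure) g"
  have G: "?G \<in> carrier_mat n n" using g(1) by simp
  have eig_g: "x ^ M = 1" if x: "eigenvalue ?G x" for x
  proof (rule M(2))
    show "E.matrix_eigenvalue n x" unfolding E.matrix_eigenvalue_def using x g(1) by blast
    show "x \<noteq> 0"
    proof
      assume "x = 0"
      then obtain v where v: "v \<in> carrier_vec n" "v \<noteq> 0\<^sub>v n" "?G *\<^sub>v v = 0 \<cdot>\<^sub>v v"
        using x G unfolding eigenvalue_def eigenvector_def by auto
      have "0 \<cdot>\<^sub>v v = 0\<^sub>v n" using v(1) by (intro eq_vecI) simp_all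
      then have "det ?G = 0"
        unfolding det_0_iff_vec_prod_zero[OF G] using v by (intro exI[of _ v]) simp
      then have "det g = 0" by (simp add: h.hom_det)
      then show False using g(2) by simp
    qed
    fix k
    obtain h where h: "h \<in> carrier_mat n n" "h ^\<^sub>m (p ^ k) = g" using roots by blast
    have "eigenvalue (map_mat to_ac h ^\<^sub>m (p ^ k)) x"
      using x by (simp flip: h.mat_hom_pow[OF h(1)] add: h(2))
    then obtain y where "eigenvalue (map_mat to_ac h) y" "y ^ (p ^ k) = x"
      using eigenvalue_of_power[of "map_mat to_ac h" n "p ^ k" x] h(1) p2(1) by auto
    then show "\<exists>y. E.matrix_eigenvalue n y \<and> y ^ (p ^ k) = x"
      unfolding E.matrix_eigenvalue_def using h(1) by blast
  qed
  let ?N = "g ^\<^sub>m M - 1\<^sub>m n"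
  have N: "?N \<in> carrier_mat n n" by (rule minus_carrier_mat) simp
  have "map_mat (to_ac :: 'a \<Rightarrow> 'a alg_closure) ?N ^\<^sub>m n = 0\<^sub>m n n"
  proof (rule only_eigenvalue_0_imp_nilpotent)
    show "map_mat to_ac ?N \<in> carrier_mat n n" using N by simp
    fix x :: "'a alg_closure" assume "eigenvalue (map_mat to_ac ?N) x"
    then have "eigenvalue (?G ^\<^sub>m M) (x + 1)"
      unfolding h.map_mat_pow_minus_one[OF g(1)] eigenvalue_minus_one_iff[OF pow_carrier_mat[OF G]] .
    then obtain y where "eigenvalue ?G y" "y ^ M = x + 1"
      using eigenvalue_of_power[OF G, of M] M(1) by auto
    then show "x = 0" using eig_g[of y] by simp
  qed
  then have "map_mat (to_ac :: 'a \<Rightarrow> 'a alg_closure) (?N ^\<^sub>m n) = 0\<^sub>m n n"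
    using h.mat_hom_pow[OF N, of n] by simp
  also have "\<dots> = map_mat to_ac (0\<^sub>m n n)" by (intro eq_matI) simp_all
  finally have "map_mat (to_ac :: 'a \<Rightarrow> 'a alg_closure) (?N ^\<^sub>m n) = map_mat to_ac (0\<^sub>m n n)" .
  then have "?N ^\<^sub>m n = 0\<^sub>m n n" by (rule h.mat_hom_inj)
  moreover have "dim_row (g ^\<^sub>m M) = n" "square_mat (g ^\<^sub>m M)" using g(1) by auto
  ultimately have "unipotent (g ^\<^sub>m M)" unfolding unipotent_def by (intro conjI exI[of _ n]) simp_all
  then show ?thesis using M(1) by blast
qed

theorem theorem1p2:
  fixes av :: "'a::field \<Rightarrow> real"
    and p n :: nat
    and G :: "'a alg_closure mat set"
    and g :: "'a mat"
  assumes "nonarchimedean_local_field av"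
    and "p = residual_characteristic av"
    and "linear_algebraic_group n G"
    and "g \<in> rational_points n G"
    and "\<And>k::nat. \<exists>h \<in> rational_points n G. h ^\<^sub>m (p ^ k) = g"
  shows "\<exists>r::nat. r \<ge> 1 \<and> unipotent (g ^\<^sub>m r)"
proof -
  interpret h: inj_comm_ring_hom "to_ac :: 'a \<Rightarrow> 'a alg_closure" by unfold_locales auto
  have g: "g \<in> carrier_mat n n" and gG: "map_mat to_ac g \<in> G"
    using assms(4) unfolding rational_points_def by auto
  have "G \<subseteq> carrier (GL n)"
    using assms(3) unfolding linear_algebraic_group_def by (auto dest: subgroup.subset)
  then have "map_mat to_ac g \<in> Units (ring_mat TYPE('a alg_closure) n ())"
    using gG by (auto simp: units_of_def)
  then have "det (map_mat (to_ac :: 'a \<Rightarrow> 'a alg_closure) g) \<noteq> 0"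
    by (rule unit_imp_det_non_zero)
  then have "det g \<noteq> 0" by (simp add: h.hom_det)
  moreover have "\<exists>h \<in> carrier_mat n n. h ^\<^sub>m (p ^ k) = g" for k
    using assms(5)[of k] unfolding rational_points_def by auto
  ultimately show ?thesis using power_root_tower_imp_unipotent[OF assms(1,2) g] by blast
qed

end
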